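(* Let $H\colon \prod_i \mathcal{C}_i \to \mathcal{D}$ be a functor and let $\mathbb{C}_1,\dots,\mathbb{C}_n$ and $\mathbb{D}$ be comonads on categories $\mathcal{C}_1,\dots,\mathcal{C}_n$ and $\mathcal{D}$, respectively, such that each of the arising Eilenberg--Moore categories of coalgebras $\mathrm{EM}(\mathbb{C}_1),\dots,\mathrm{EM}(\mathbb{C}_n),\mathrm{EM}(\mathbb{D})$ is a path category and, furthermore, $\mathrm{EM}(\mathbb{D})$ has equalisers. If $H$ preserves embeddings and there exists a Kleisli law $\kappa$ of type $\mathbb{D}\circ H \Rightarrow H \circ \prod_i\mathbb{C}_i$ satisfying axiom (S2') (stated in the context), then \[ A_1 \equiv_{\mathbb{C}_1} B_1, \;\ldots,\; A_n \equiv_{\mathbb{C}_n} B_n \] implies \[ H(A_1,\dots,A_n) \;\equiv_{\mathbb{D}}\; H(B_1,\dots,B_n). \]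
   Context: A path category is a category equipped with a proper factorisation system $(\mathcal{E},\mathcal{M})$ (morphisms in $\mathcal{E}$ are called quotients and are epimorphisms; morphisms in $\mathcal{M}$ are called embeddings and are monomorphisms) together with a chosen class of path objects. In the setting considered, the base categories $\mathcal{C}_i,\mathcal{D}$ carry proper factorisation systems, the comonads preserve embeddings, and the factorisation system on a category of coalgebras is lifted from the base: a coalgebra morphism is a quotient (resp. embedding) iff its underlying morphism is a quotient (resp. embedding) in the base category. $H$ preserves embeddings means $H(f_1,\dots,f_n)$ is an embedding whenever each $f_i$ is. In a path category, a path embedding is an embedding $e\colon P\rightarrowtail X$ with $P$ a path. A morphism $f\colon X\to Y$ is a pathwise-embedding if $f\circ e$ is an embedding for every path embedding $e\colon P\rightarrowtail X$. It is open if for every commutative square $f\circ e = m\circ g$ with $e\colon P\rightarrowtail X$, $g\colon P\rightarrowtail Q$, $m\colon Q\rightarrowtail Y$ path embeddings, there is $d\colon Q\to X$ with $e=d\circ g$ and $m=f\circ d$. For a comonad $\mathbb{C}$ (with counit $\varepsilon$ and comultiplication $\delta$), a coalgebra $(A,\alpha)$ is a morphism $\alpha\colon A\to\mathbb{C}(A)$ with $\varepsilon_A\circ\alpha=\mathrm{id}$ and $\delta_A\circ\alpha=\mathbb{C}(\alpha)\circ\alpha$; the cofree coalgebra on $A$ is $F^{\mathbb{C}}(A)=(\mathbb{C}(A),\delta_A)$. For objects $A,B$, $A\equiv_{\mathbb{C}} B$ means there exists a span $F^{\mathbb{C}}(A)\leftarrow Z\rightarrow F^{\mathbb{C}}(B)$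 of open pathwise-embeddings in $\mathrm{EM}(\mathbb{C})$. A Kleisli law is a natural transformation $\kappa\colon \mathbb{D}\circ H\Rightarrow H\circ\prod_i\mathbb{C}_i$ such that (K1) $H(\prod_i\varepsilon)\circ\kappa=\varepsilon_H$ and (K2) $H(\prod_i\delta)\circ\kappa=\kappa_{\prod_i \mathbb{C}_i}\circ\mathbb{D}\kappa\circ\delta_H$. Given $\kappa$, a bimorphism from a $\mathbb{D}$-coalgebra $(A,\alpha)$ to $\mathbb{C}_i$-coalgebras $(B_i,\beta_i)$, written $\alpha\to[\beta_1,\dots,\beta_n]$, is a morphism $g\colon A\to H(B_1,\dots,B_n)$ in $\mathcal{D}$ with $H(\beta_1,\dots,\beta_n)\circ g=\kappa\circ\mathbb{D}(g)\circ\alpha$. Axiom (S2'): for any path $(P,\pi)$ in $\mathrm{EM}(\mathbb{D})$ and coalgebras $(A_i,\alpha_i)$ in $\mathrm{EM}(\mathbb{C}_i)$, $1\le i\le n$, every bimorphism $f\colon\pi\to[\alpha_1,\dots,\alpha_n]$ has a minimal decomposition as $f=H(e_1,\dots,e_n)\circ f_0$ with $f_0\colon P\to H(P_1,\dots,P_n)$ and path embeddings $e_i\colon(P_i,\pi_i)\rightarrowtail(A_i,\alpha_i)$; minimality means that for any other such decomposition $f=H(g_1,\dots,g_n)\circ g_0$ with path embeddings $g_i\colon(Q_i,\rho_i)\rightarrowtail(A_i,\alpha_i)$ there exist morphisms $h_i\colon P_i\to Q_i$ with $e_i=g_i\circ h_i$ for all $i$. *)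

theory Defs
  imports "HOL-Library.FuncSet"
begin

record ('o, 'm) cat =
  Ob :: "'o set"
  Ar :: "'m set"
  Dom :: "'m \<Rightarrow> 'o"
  Cod :: "'m \<Rightarrow> 'o"
  Id :: "'o \<Rightarrow> 'm"
  Cmp :: "'m \<Rightarrow> 'm \<Rightarrow> 'm"  (infixr "\<cdot>\<index>" 70)

definition hom :: "('o, 'm, 'z) cat_scheme \<Rightarrow> 'o \<Rightarrow> 'o \<Rightarrow> 'm set" where
  "hom C X Y = {f \<in> Ar C. Dom C f = X \<and> Cod C f = Y}"

locale category =
  fixes C :: "('o, 'm, 'z) cat_scheme" (structure)
  assumes Dom_Ob: "f \<in> Ar C \<Longrightarrow> Dom C f \<in> Ob C"
    and Cod_Ob: "f \<in> Ar C \<Longrightarrow> Cod C f \<in> Ob C"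
    and Id_hom: "X \<in> Ob C \<Longrightarrow> Id C X \<in> hom C X X"
    and Cmp_hom: "\<lbrakk>f \<in> hom C X Y; g \<in> hom C Y Z\<rbrakk> \<Longrightarrow> g \<cdot> f \<in> hom C X Z"
    and Cmp_Id_right: "f \<in> hom C X Y \<Longrightarrow> f \<cdot> Id C X = f"
    and Cmp_Id_left: "f \<in> hom C X Y \<Longrightarrow> Id C Y \<cdot> f = f"
    and Cmp_assoc: "\<lbrakk>f \<in> hom C W X; g \<in> hom C X Y; h \<in> hom C Y Z\<rbrakk>
                      \<Longrightarrow> (h \<cdot> g) \<cdot> f = h \<cdot> (g \<cdot> f)"

definition mono_arr :: "('o, 'm, 'z) cat_scheme \<Rightarrow> 'm \<Rightarrow> bool" where
  "mono_arr C m \<longleftrightarrow> m \<in> Ar C \<and>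
     (\<forall>u v X. u \<in> hom C X (Dom C m) \<longrightarrow> v \<in> hom C X (Dom C m) \<longrightarrow>
        m \<cdot>\<^bsub>C\<^esub> u = m \<cdot>\<^bsub>C\<^esub> v \<longrightarrow> u = v)"

definition epi_arr :: "('o, 'm, 'z) cat_scheme \<Rightarrow> 'm \<Rightarrow> bool" where
  "epi_arr C e \<longleftrightarrow> e \<in> Ar C \<and>
     (\<forall>u v X. u \<in> hom C (Cod C e) X \<longrightarrow> v \<in> hom C (Cod C e) X \<longrightarrow>
        u \<cdot>\<^bsub>C\<^esub> e = v \<cdot>\<^bsub>C\<^esub> e \<longrightarrow> u = v)"

definition is_equaliser :: "('o, 'm, 'z) cat_scheme \<Rightarrow> 'm \<Rightarrow> 'm \<Rightarrow> 'm \<Rightarrow> bool" where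
  "is_equaliser C f g e \<longleftrightarrow>
     e \<in> Ar C \<and> Cod C e = Dom C f \<and> f \<cdot>\<^bsub>C\<^esub> e = g \<cdot>\<^bsub>C\<^esub> e \<and>
     (\<forall>W. \<forall>u \<in> hom C W (Dom C f). f \<cdot>\<^bsub>C\<^esub> u = g \<cdot>\<^bsub>C\<^esub> u \<longrightarrow>
        (\<exists>!v. v \<in> hom C W (Dom C e) \<and> e \<cdot>\<^bsub>C\<^esub> v = u))"

definition has_equalisers :: "('o, 'm, 'z) cat_scheme \<Rightarrow> bool" where
  "has_equalisers C \<longleftrightarrow>
     (\<forall>X Y. \<forall>f \<in> hom C X Y. \<forall>g \<in> hom C X Y. \<exists>e. is_equaliser C f g e)"

record ('o, 'm, 'p, 'q) func =
  omap :: "'o \<Rightarrow> 'p"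
  amap :: "'m \<Rightarrow> 'q"

locale cat_functor = source: category C + target: category D
  for C :: "('o, 'm, 'y) cat_scheme"
    and D :: "('p, 'q, 'z) cat_scheme"
    and F :: "('o, 'm, 'p, 'q, 'x) func_scheme" +
  assumes omap_Ob: "X \<in> Ob C \<Longrightarrow> omap F X \<in> Ob D"
    and amap_hom: "f \<in> hom C X Y \<Longrightarrow> amap F f \<in> hom D (omap F X) (omap F Y)"
    and amap_Id: "X \<in> Ob C \<Longrightarrow> amap F (Id C X) = Id D (omap F X)"
    and amap_Cmp: "\<lbrakk>f \<in> hom C X Y; g \<in> hom C Y Z\<rbrakk>
                     \<Longrightarrow> amap F (g \<cdot>\<^bsub>C\<^esub> f) = amap F g \<cdot>\<^bsub>D\<^esub> amap F f"

definition id_func :: "('o, 'm, 'o, 'm) func" where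
  "id_func = \<lparr>omap = \<lambda>X. X, amap = \<lambda>f. f\<rparr>"

definition comp_func ::
  "('p, 'q, 'r, 's, 'y) func_scheme \<Rightarrow> ('o, 'm, 'p, 'q, 'z) func_scheme \<Rightarrow> ('o, 'm, 'r, 's) func"
  where
  "comp_func G F = \<lparr>omap = \<lambda>X. omap G (omap F X), amap = \<lambda>f. amap G (amap F f)\<rparr>"

locale nat_trans = F: cat_functor C D F + G: cat_functor C D G
  for C :: "('o, 'm, 'y) cat_scheme"
    and D :: "('p, 'q, 'z) cat_scheme"
    and F :: "('o, 'm, 'p, 'q, 'v) func_scheme"
    and G :: "('o, 'm, 'p, 'q, 'w) func_scheme"
    and \<tau> :: "'o \<Rightarrow> 'q" +
  assumes component_hom: "X \<in> Ob C \<Longrightarrow> \<tau> X \<in> hom D (omap F X) (omap G X)"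
    and naturality: "f \<in> hom C X Y \<Longrightarrow> \<tau> Y \<cdot>\<^bsub>D\<^esub> amap F f = amap G f \<cdot>\<^bsub>D\<^esub> \<tau> X"

text \<open>Objects and arrows of a product category are extensional families, so that two
  tuples are equal as soon as they agree on the index set.\<close>

definition prod_cat ::
  "'i set \<Rightarrow> ('i \<Rightarrow> ('o, 'm, 'z) cat_scheme) \<Rightarrow> ('i \<Rightarrow> 'o, 'i \<Rightarrow> 'm) cat" where
  "prod_cat I C =
     \<lparr>Ob = (\<Pi>\<^sub>E i\<in>I. Ob (C i)),
      Ar = (\<Pi>\<^sub>E i\<in>I. Ar (C i)),
      Dom = \<lambda>f. \<lambda>i\<in>I. Dom (C i) (f i),
      Cod = \<lambda>f. \<lambda>i\<in>I. Cod (C i) (f i),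
      Id = \<lambda>X. \<lambda>i\<in>I. Id (C i) (X i),
      Cmp = \<lambda>g f. \<lambda>i\<in>I. g i \<cdot>\<^bsub>C i\<^esub> f i\<rparr>"

definition prod_func ::
  "'i set \<Rightarrow> ('i \<Rightarrow> ('o, 'm, 'p, 'q, 'z) func_scheme)
     \<Rightarrow> ('i \<Rightarrow> 'o, 'i \<Rightarrow> 'm, 'i \<Rightarrow> 'p, 'i \<Rightarrow> 'q) func" where
  "prod_func I F =
     \<lparr>omap = \<lambda>X. \<lambda>i\<in>I. omap (F i) (X i),
      amap = \<lambda>f. \<lambda>i\<in>I. amap (F i) (f i)\<rparr>"

record ('o, 'm) fact_cat = "('o, 'm) cat" +
  Quot :: "'m set"
  Emb :: "'m set"

definition has_lifting :: "('o, 'm, 'z) cat_scheme \<Rightarrow> 'm \<Rightarrow> 'm \<Rightarrow> bool" where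
  "has_lifting C e m \<longleftrightarrow>
     (\<forall>u \<in> hom C (Dom C e) (Dom C m). \<forall>v \<in> hom C (Cod C e) (Cod C m).
        m \<cdot>\<^bsub>C\<^esub> u = v \<cdot>\<^bsub>C\<^esub> e \<longrightarrow>
        (\<exists>d \<in> hom C (Cod C e) (Dom C m). d \<cdot>\<^bsub>C\<^esub> e = u \<and> m \<cdot>\<^bsub>C\<^esub> d = v))"

locale proper_fact_category = category C
  for C :: "('o, 'm, 'z) fact_cat_scheme" (structure) +
  assumes factorisation:
      "f \<in> hom C X Y \<Longrightarrow>
         \<exists>Z. \<exists>e \<in> Quot C \<inter> hom C X Z. \<exists>m \<in> Emb C \<inter> hom C Z Y. f = m \<cdot> e"
    and Quot_eq: "Quot C = {e \<in> Ar C. \<forall>m \<in> Emb C. has_lifting C e m}"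
    and Emb_eq: "Emb C = {m \<in> Ar C. \<forall>e \<in> Quot C. has_lifting C e m}"
    and Quot_epi: "e \<in> Quot C \<Longrightarrow> epi_arr C e"
    and Emb_mono: "m \<in> Emb C \<Longrightarrow> mono_arr C m"

record ('o, 'm) path_cat = "('o, 'm) fact_cat" +
  Paths :: "'o set"

locale path_category = proper_fact_category C
  for C :: "('o, 'm, 'z) path_cat_scheme" (structure) +
  assumes Paths_Ob: "Paths C \<subseteq> Ob C"

definition path_embedding :: "('o, 'm, 'z) path_cat_scheme \<Rightarrow> 'm \<Rightarrow> bool" where
  "path_embedding C e \<longleftrightarrow> e \<in> Emb C \<and> Dom C e \<in> Paths C"

definition pathwise_embedding :: "('o, 'm, 'z) path_cat_scheme \<Rightarrow> 'm \<Rightarrow> bool" where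
  "pathwise_embedding C f \<longleftrightarrow> f \<in> Ar C \<and>
     (\<forall>e. path_embedding C e \<longrightarrow> Cod C e = Dom C f \<longrightarrow> f \<cdot>\<^bsub>C\<^esub> e \<in> Emb C)"

definition open_arr :: "('o, 'm, 'z) path_cat_scheme \<Rightarrow> 'm \<Rightarrow> bool" where
  "open_arr C f \<longleftrightarrow> f \<in> Ar C \<and>
     (\<forall>P Q e g m.
        path_embedding C e \<longrightarrow> e \<in> hom C P (Dom C f) \<longrightarrow>
        path_embedding C g \<longrightarrow> g \<in> hom C P Q \<longrightarrow>
        path_embedding C m \<longrightarrow> m \<in> hom C Q (Cod C f) \<longrightarrow>
        f \<cdot>\<^bsub>C\<^esub> e = m \<cdot>\<^bsub>C\<^esub> g \<longrightarrow>
        (\<exists>d \<in> hom C Q (Dom C f). e = d \<cdot>\<^bsub>C\<^esub> g \<and> m = f \<cdot>\<^bsub>C\<^esub> d))"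

definition open_pathwise_embedding :: "('o, 'm, 'z) path_cat_scheme \<Rightarrow> 'm \<Rightarrow> bool" where
  "open_pathwise_embedding C f \<longleftrightarrow> pathwise_embedding C f \<and> open_arr C f"

record ('o, 'm) comonad_data = "('o, 'm, 'o, 'm) func" +
  counit :: "'o \<Rightarrow> 'm"
  comult :: "'o \<Rightarrow> 'm"

locale comonad =
  counit: nat_trans C C T id_func "counit T" +
  comult: nat_trans C C T "comp_func T T" "comult T"
  for C :: "('o, 'm, 'y) cat_scheme" (structure)
    and T :: "('o, 'm, 'z) comonad_data_scheme" +
  assumes counit_left: "X \<in> Ob C \<Longrightarrow> counit T (omap T X) \<cdot> comult T X = Id C (omap T X)"
    and counit_right: "X \<in> Ob C \<Longrightarrow> amap T (counit T X) \<cdot> comult T X = Id C (omap T X)"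
    and coassoc: "X \<in> Ob C \<Longrightarrow>
           comult T (omap T X) \<cdot> comult T X = amap T (comult T X) \<cdot> comult T X"

definition comonad_preserves_emb ::
  "('o, 'm, 'y) fact_cat_scheme \<Rightarrow> ('o, 'm, 'z) comonad_data_scheme \<Rightarrow> bool" where
  "comonad_preserves_emb C T \<longleftrightarrow> (\<forall>f \<in> Emb C. amap T f \<in> Emb C)"

type_synonym ('o, 'm) coalg = "'o \<times> 'm"

text \<open>A coalgebra morphism carries its source and target coalgebras, since the underlying
  arrow does not determine the structure maps.\<close>

type_synonym ('o, 'm) coalg_mor = "('o, 'm) coalg \<times> 'm \<times> ('o, 'm) coalg"

abbreviation under :: "('o, 'm) coalg_mor \<Rightarrow> 'm" where
  "under h \<equiv> fst (snd h)"

definition coalgebras ::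
  "('o, 'm, 'y) cat_scheme \<Rightarrow> ('o, 'm, 'z) comonad_data_scheme \<Rightarrow> ('o, 'm) coalg set" where
  "coalgebras C T =
     {(A, \<alpha>). A \<in> Ob C \<and> \<alpha> \<in> hom C A (omap T A) \<and>
        counit T A \<cdot>\<^bsub>C\<^esub> \<alpha> = Id C A \<and>
        comult T A \<cdot>\<^bsub>C\<^esub> \<alpha> = amap T \<alpha> \<cdot>\<^bsub>C\<^esub> \<alpha>}"

definition coalg_mors ::
  "('o, 'm, 'y) cat_scheme \<Rightarrow> ('o, 'm, 'z) comonad_data_scheme \<Rightarrow> ('o, 'm) coalg_mor set" where
  "coalg_mors C T =
     {((A, \<alpha>), f, (B, \<beta>)) | A \<alpha> f B \<beta>.
        (A, \<alpha>) \<in> coalgebras C T \<and> (B, \<beta>) \<in> coalgebras C T \<and>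
        f \<in> hom C A B \<and> \<beta> \<cdot>\<^bsub>C\<^esub> f = amap T f \<cdot>\<^bsub>C\<^esub> \<alpha>}"

text \<open>The factorisation system is lifted from \<open>C\<close>; \<open>P\<close> is the chosen class of path coalgebras.\<close>

definition EM ::
  "('o, 'm, 'y) fact_cat_scheme \<Rightarrow> ('o, 'm, 'z) comonad_data_scheme \<Rightarrow> ('o, 'm) coalg set
     \<Rightarrow> (('o, 'm) coalg, ('o, 'm) coalg_mor) path_cat" where
  "EM C T P =
     \<lparr>Ob = coalgebras C T,
      Ar = coalg_mors C T,
      Dom = \<lambda>h. fst h,
      Cod = \<lambda>h. snd (snd h),
      Id = \<lambda>a. (a, Id C (fst a), a),
      Cmp = \<lambda>k h. (fst h, under k \<cdot>\<^bsub>C\<^esub> under h, snd (snd k)),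
      Quot = {h \<in> coalg_mors C T. under h \<in> Quot C},
      Emb = {h \<in> coalg_mors C T. under h \<in> Emb C},
      Paths = P\<rparr>"

definition cofree :: "('o, 'm, 'z) comonad_data_scheme \<Rightarrow> 'o \<Rightarrow> ('o, 'm) coalg" where
  "cofree T A = (omap T A, comult T A)"

definition comonad_equiv ::
  "('o, 'm, 'y) fact_cat_scheme \<Rightarrow> ('o, 'm, 'z) comonad_data_scheme \<Rightarrow> ('o, 'm) coalg set
     \<Rightarrow> 'o \<Rightarrow> 'o \<Rightarrow> bool" where
  "comonad_equiv C T P A B \<longleftrightarrow>
     (\<exists>Z \<in> Ob (EM C T P).
        \<exists>f \<in> hom (EM C T P) Z (cofree T A). \<exists>g \<in> hom (EM C T P) Z (cofree T B).
          open_pathwise_embedding (EM C T P) f \<and> open_pathwise_embedding (EM C T P) g)"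

locale kleisli_law =
  nat_trans "prod_cat I C" D "comp_func S H" "comp_func H (prod_func I T)" \<kappa>
  for I :: "'i set"
    and C :: "'i \<Rightarrow> ('o, 'm, 'u) cat_scheme"
    and T :: "'i \<Rightarrow> ('o, 'm, 'v) comonad_data_scheme"
    and D :: "('p, 'q, 'w) cat_scheme" (structure)
    and S :: "('p, 'q, 'x) comonad_data_scheme"
    and H :: "('i \<Rightarrow> 'o, 'i \<Rightarrow> 'm, 'p, 'q, 'y) func_scheme"
    and \<kappa> :: "('i \<Rightarrow> 'o) \<Rightarrow> 'q" +
  assumes K1: "X \<in> Ob (prod_cat I C) \<Longrightarrow>
      amap H (\<lambda>i\<in>I. counit (T i) (X i)) \<cdot> \<kappa> X = counit S (omap H X)"
    and K2: "X \<in> Ob (prod_cat I C) \<Longrightarrow>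
      amap H (\<lambda>i\<in>I. comult (T i) (X i)) \<cdot> \<kappa> X
        = \<kappa> (omap (prod_func I T) X) \<cdot> amap S (\<kappa> X) \<cdot> comult S (omap H X)"

definition functor_preserves_emb ::
  "'i set \<Rightarrow> ('i \<Rightarrow> ('o, 'm, 'x) fact_cat_scheme) \<Rightarrow> ('p, 'q, 'y) fact_cat_scheme
     \<Rightarrow> ('i \<Rightarrow> 'o, 'i \<Rightarrow> 'm, 'p, 'q, 'z) func_scheme \<Rightarrow> bool" where
  "functor_preserves_emb I C D H \<longleftrightarrow> (\<forall>f \<in> (\<Pi>\<^sub>E i\<in>I. Emb (C i)). amap H f \<in> Emb D)"

definition bimorphism ::
  "'i set \<Rightarrow> ('p, 'q, 'x) cat_scheme \<Rightarrow> ('p, 'q, 'y) comonad_data_scheme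
     \<Rightarrow> ('i \<Rightarrow> 'o, 'i \<Rightarrow> 'm, 'p, 'q, 'z) func_scheme \<Rightarrow> (('i \<Rightarrow> 'o) \<Rightarrow> 'q)
     \<Rightarrow> ('p, 'q) coalg \<Rightarrow> ('i \<Rightarrow> ('o, 'm) coalg) \<Rightarrow> 'q \<Rightarrow> bool" where
  "bimorphism I D S H \<kappa> a b g \<longleftrightarrow>
     g \<in> hom D (fst a) (omap H (\<lambda>i\<in>I. fst (b i))) \<and>
     amap H (\<lambda>i\<in>I. snd (b i)) \<cdot>\<^bsub>D\<^esub> g
       = \<kappa> (\<lambda>i\<in>I. fst (b i)) \<cdot>\<^bsub>D\<^esub> amap S g \<cdot>\<^bsub>D\<^esub> snd a"

text \<open>A decomposition \<open>f = H(e\<^sub>1, \<dots>, e\<^sub>n) \<circ> f\<^sub>0\<close> through path embeddings \<open>e\<^sub>i\<close> into the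
  coalgebras \<open>b\<^sub>i\<close>; the path coalgebra that is the source of \<open>e\<^sub>i\<close> is \<open>Dom (E i) (e i)\<close>,
  where \<open>E i\<close> is the \<open>i\<close>-th Eilenberg--Moore category.\<close>

definition decomposition ::
  "'i set \<Rightarrow> ('i \<Rightarrow> (('o, 'm) coalg, ('o, 'm) coalg_mor, 'x) path_cat_scheme)
     \<Rightarrow> ('p, 'q, 'y) cat_scheme \<Rightarrow> ('i \<Rightarrow> 'o, 'i \<Rightarrow> 'm, 'p, 'q, 'z) func_scheme
     \<Rightarrow> ('p, 'q) coalg \<Rightarrow> ('i \<Rightarrow> ('o, 'm) coalg) \<Rightarrow> 'q
     \<Rightarrow> ('i \<Rightarrow> ('o, 'm) coalg_mor) \<Rightarrow> 'q \<Rightarrow> bool" where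
  "decomposition I E D H a b f e f0 \<longleftrightarrow>
     (\<forall>i\<in>I. path_embedding (E i) (e i) \<and> Cod (E i) (e i) = b i) \<and>
     f0 \<in> hom D (fst a) (omap H (\<lambda>i\<in>I. fst (Dom (E i) (e i)))) \<and>
     f = amap H (\<lambda>i\<in>I. under (e i)) \<cdot>\<^bsub>D\<^esub> f0"

definition axiom_S2' ::
  "'i set \<Rightarrow> ('i \<Rightarrow> ('o, 'm, 'u) fact_cat_scheme) \<Rightarrow> ('i \<Rightarrow> ('o, 'm, 'v) comonad_data_scheme)
     \<Rightarrow> ('i \<Rightarrow> ('o, 'm) coalg set)
     \<Rightarrow> ('p, 'q, 'w) fact_cat_scheme \<Rightarrow> ('p, 'q, 'x) comonad_data_scheme \<Rightarrow> ('p, 'q) coalg set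
     \<Rightarrow> ('i \<Rightarrow> 'o, 'i \<Rightarrow> 'm, 'p, 'q, 'y) func_scheme \<Rightarrow> (('i \<Rightarrow> 'o) \<Rightarrow> 'q) \<Rightarrow> bool" where
  "axiom_S2' I C T P D S R H \<kappa> \<longleftrightarrow>
     (let E = (\<lambda>i. EM (C i) (T i) (P i)) in
      \<forall>p \<in> Paths (EM D S R). \<forall>a. (\<forall>i\<in>I. a i \<in> Ob (E i)) \<longrightarrow>
        (\<forall>f. bimorphism I D S H \<kappa> p a f \<longrightarrow>
           (\<exists>e f0. decomposition I E D H p a f e f0 \<and>
              (\<forall>g g0. decomposition I E D H p a f g g0 \<longrightarrow>
                 (\<exists>h. \<forall>i\<in>I. h i \<in> hom (E i) (Dom (E i) (e i)) (Dom (E i) (g i)) \<and>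
                            e i = g i \<cdot>\<^bsub>E i\<^esub> h i)))))"

end

theory Submission
  imports Defs
begin

text \<open>The functor \<open>H\<close> is lifted to coalgebras: for coalgebras \<open>\<zeta>\<^sub>i\<close> on \<open>Z\<^sub>i\<close>, an equaliser \<open>W\<close> in
  \<open>EM(D)\<close> carries a universal bimorphism \<open>u : W \<rightarrow> [\<zeta>\<^sub>1, \<dots>, \<zeta>\<^sub>n]\<close>, and the lift of the cofree
  coalgebras is cofree, because bimorphisms into \<open>[F A\<^sub>1, \<dots>, F A\<^sub>n]\<close> are arrows into
  \<open>H(A\<^sub>1, \<dots>, A\<^sub>n)\<close>. So morphisms \<open>f\<^sub>i : \<zeta>\<^sub>i \<rightarrow> F A\<^sub>i\<close> induce \<open>\<phi> : W \<rightarrow> F(H(A\<^sub>1, \<dots>, A\<^sub>n))\<close>, and it remains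
  to see that \<open>\<phi>\<close> is an open pathwise embedding if all \<open>f\<^sub>i\<close> are. A path embedding into \<open>W\<close> is a
  bimorphism \<open>b = H(e) \<circ> b\<^sub>0\<close> with path embeddings \<open>e\<^sub>i\<close>, and \<open>H(f) \<circ> b = H(f \<circ> e) \<circ> b\<^sub>0\<close> where the
  \<open>f\<^sub>i \<circ> e\<^sub>i\<close> are embeddings. For openness, a square from \<open>g : P \<rightarrow> Q\<close> gives
  \<open>H(f \<circ> e) \<circ> b\<^sub>0 = H(k) \<circ> M\<^sub>0 \<circ> g\<close>, and a minimal decomposition of this bimorphism maps to both
  sides; the resulting squares for the \<open>f\<^sub>i\<close> have diagonal fillers \<open>d\<^sub>i\<close>, and \<open>H(d) \<circ> M\<^sub>0\<close> is the
  filler for \<open>\<phi>\<close>.\<close>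

section \<open>Hom sets, equalisers and open pathwise-embeddings\<close>

lemma homD: "f \<in> hom C X Y \<Longrightarrow> f \<in> Ar C \<and> Dom C f = X \<and> Cod C f = Y"
  by (simp add: hom_def)

lemma homI: "f \<in> Ar C \<Longrightarrow> Dom C f = X \<Longrightarrow> Cod C f = Y \<Longrightarrow> f \<in> hom C X Y"
  by (simp add: hom_def)

lemma is_equaliserD:
  assumes "is_equaliser C f g q" "f \<in> hom C X Y"
  shows "q \<in> hom C (Dom C q) X" "f \<cdot>\<^bsub>C\<^esub> q = g \<cdot>\<^bsub>C\<^esub> q"
    "\<lbrakk>r \<in> hom C W X; f \<cdot>\<^bsub>C\<^esub> r = g \<cdot>\<^bsub>C\<^esub> r\<rbrakk> \<Longrightarrow> \<exists>!v. v \<in> hom C W (Dom C q) \<and> q \<cdot>\<^bsub>C\<^esub> v = r"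
proof -
  have X: "Dom C f = X" using homD[OF assms(2)] by simp
  show "q \<in> hom C (Dom C q) X" "f \<cdot>\<^bsub>C\<^esub> q = g \<cdot>\<^bsub>C\<^esub> q"
    using assms(1) X unfolding is_equaliser_def by (simp_all only: homI)
  show "\<exists>!v. v \<in> hom C W (Dom C q) \<and> q \<cdot>\<^bsub>C\<^esub> v = r"
    if "r \<in> hom C W X" "f \<cdot>\<^bsub>C\<^esub> r = g \<cdot>\<^bsub>C\<^esub> r"
    using assms(1) that unfolding is_equaliser_def X by (elim conjE) (drule spec, drule (1) bspec, drule (1) mp)
qed

lemma path_embeddingI:
  "\<lbrakk>e \<in> hom C X Y; e \<in> Emb C; X \<in> Paths C\<rbrakk> \<Longrightarrow> path_embedding C e"
  by (simp add: path_embedding_def hom_def)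

lemma path_embeddingD:
  assumes "path_embedding C e" "e \<in> hom C X Y"
  shows "e \<in> Emb C" "X \<in> Paths C"
  using assms by (auto simp: path_embedding_def hom_def)

lemma open_pathwise_embeddingD:
  assumes "open_pathwise_embedding C f" "f \<in> hom C X Y"
  shows "\<lbrakk>path_embedding C e; e \<in> hom C P X\<rbrakk> \<Longrightarrow> f \<cdot>\<^bsub>C\<^esub> e \<in> Emb C"
    and "\<lbrakk>path_embedding C e; path_embedding C g; path_embedding C m; e \<in> hom C P X;
      g \<in> hom C P Q; m \<in> hom C Q Y; f \<cdot>\<^bsub>C\<^esub> e = m \<cdot>\<^bsub>C\<^esub> g\<rbrakk>
      \<Longrightarrow> \<exists>d. d \<in> hom C Q X \<and> e = d \<cdot>\<^bsub>C\<^esub> g \<and> m = f \<cdot>\<^bsub>C\<^esub> d"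
proof -
  have XY: "Dom C f = X" "Cod C f = Y" using homD[OF assms(2)] by simp_all
  show "f \<cdot>\<^bsub>C\<^esub> e \<in> Emb C" if "path_embedding C e" "e \<in> hom C P X"
    using assms(1) that homD[OF that(2)]
    unfolding open_pathwise_embedding_def pathwise_embedding_def XY by simp
  assume "path_embedding C e" "path_embedding C g" "path_embedding C m" "e \<in> hom C P X"
    "g \<in> hom C P Q" "m \<in> hom C Q Y" "f \<cdot>\<^bsub>C\<^esub> e = m \<cdot>\<^bsub>C\<^esub> g"
  then show "\<exists>d. d \<in> hom C Q X \<and> e = d \<cdot>\<^bsub>C\<^esub> g \<and> m = f \<cdot>\<^bsub>C\<^esub> d"
    using assms(1) unfolding open_pathwise_embedding_def open_arr_def XY by blast
qed

text \<open>The squares of path embeddings that define openness are among the squares over paths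
  \<open>P\<close> and \<open>Q\<close> for which \<open>lift\<close> supplies a filler. The
  inclusion \<open>Emb_Ar\<close> types an embedding with codomain \<open>X\<close> as an element of
  a hom set.\<close>

lemma open_pathwise_embeddingI:
  assumes f: "f \<in> hom C X Y"
    and emb: "\<And>P e. \<lbrakk>e \<in> hom C P X; e \<in> Emb C; P \<in> Paths C\<rbrakk> \<Longrightarrow> f \<cdot>\<^bsub>C\<^esub> e \<in> Emb C"
    and lift: "\<And>P Q e g m. \<lbrakk>e \<in> hom C P X; g \<in> hom C P Q; m \<in> hom C Q Y; P \<in> Paths C; Q \<in> Paths C;
      f \<cdot>\<^bsub>C\<^esub> e = m \<cdot>\<^bsub>C\<^esub> g\<rbrakk> \<Longrightarrow> \<exists>d \<in> hom C Q X. e = d \<cdot>\<^bsub>C\<^esub> g \<and> m = f \<cdot>\<^bsub>C\<^esub> d"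
    and Emb_Ar: "Emb C \<subseteq> Ar C"
  shows "open_pathwise_embedding C f"
proof -
  have XY: "Dom C f = X" "Cod C f = Y" "f \<in> Ar C" using homD[OF f] by simp_all
  have "pathwise_embedding C f"
    unfolding pathwise_embedding_def XY
  proof (intro conjI allI impI)
    fix e assume e: "path_embedding C e" "Cod C e = X"
    then have "e \<in> Emb C" "Dom C e \<in> Paths C" by (simp_all add: path_embedding_def)
    with emb[of e "Dom C e"] e(2) Emb_Ar show "f \<cdot>\<^bsub>C\<^esub> e \<in> Emb C" by (auto simp: hom_def)
  qed (rule XY)
  moreover have "open_arr C f"
    unfolding open_arr_def XY
  proof (intro conjI allI impI)
    fix P Q e g m
    assume e: "e \<in> hom C P X" and g: "path_embedding C g" "g \<in> hom C P Q"
      and m: "path_embedding C m" "m \<in> hom C Q Y" and sq: "f \<cdot>\<^bsub>C\<^esub> e = m \<cdot>\<^bsub>C\<^esub> g"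
    show "\<exists>d \<in> hom C Q X. e = d \<cdot>\<^bsub>C\<^esub> g \<and> m = f \<cdot>\<^bsub>C\<^esub> d"
      by (rule lift[OF e g(2) m(2) path_embeddingD(2)[OF g] path_embeddingD(2)[OF m] sq])
  qed (rule XY)
  ultimately show ?thesis by (simp add: open_pathwise_embedding_def)
qed

section \<open>Composition calculus in a category\<close>

context category
begin

lemma hom_DomCod: "f \<in> Ar C \<Longrightarrow> f \<in> hom C (Dom C f) (Cod C f)"
  by (simp add: hom_def)

text \<open>The typing is expressed by \<open>Ar\<close>, \<open>Dom\<close> and \<open>Cod\<close>
  because the intermediate objects of the \<open>hom\<close> versions occur only in premises. In
  this form, and with \<open>homD\<close> facts for the arrows involved, the simplifier decides the
  side conditions and brings composites into right-associated form; this is how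
  \<open>cat_simps\<close> is used below.\<close>

lemma Cmp_Ar:
  assumes "f \<in> Ar C" "g \<in> Ar C" "Cod C f = Dom C g"
  shows "g \<cdot> f \<in> Ar C" "Dom C (g \<cdot> f) = Dom C f" "Cod C (g \<cdot> f) = Cod C g"
  using Cmp_hom[of f "Dom C f" "Cod C f" g "Cod C g"] assms by (auto simp: hom_def)

lemma Cmp_assoc_Ar:
  assumes "f \<in> Ar C" "g \<in> Ar C" "h \<in> Ar C" "Cod C f = Dom C g" "Cod C g = Dom C h"
  shows "(h \<cdot> g) \<cdot> f = h \<cdot> (g \<cdot> f)"
  using Cmp_assoc[of f "Dom C f" "Cod C f" g "Cod C g" h "Cod C h"] assms by (auto simp: hom_def)

lemma Cmp_Id_Ar:
  assumes "f \<in> Ar C"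
  shows "Dom C f = X \<Longrightarrow> f \<cdot> Id C X = f" "Cod C f = Y \<Longrightarrow> Id C Y \<cdot> f = f"
  using Cmp_Id_left Cmp_Id_right hom_DomCod assms by blast+

lemmas cat_simps = Cmp_Ar Cmp_assoc_Ar Cmp_Id_Ar

lemma Cmp_eq_extend:
  assumes "g \<cdot> f = k" "f \<in> hom C X Y" "g \<in> hom C Y Z" "x \<in> hom C W X"
  shows "g \<cdot> f \<cdot> x = k \<cdot> x"
  using Cmp_assoc[OF assms(4,2,3)] assms(1) by simp

lemma mono_cancel:
  assumes "mono_arr C m" "m \<in> hom C Y Z" "u \<in> hom C X Y" "v \<in> hom C X Y" "m \<cdot> u = m \<cdot> v"
  shows "u = v"
  using assms unfolding mono_arr_def by (metis homD)

end

section \<open>Embeddings in a proper factorisation system\<close>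

context proper_fact_category
begin

lemma Emb_Ar: "m \<in> Emb C \<Longrightarrow> m \<in> Ar C"
  using Emb_eq by auto

text \<open>By \<open>Emb_eq\<close> the right lifting property against all quotients characterises
  embeddings.\<close>

lemma EmbI:
  assumes m: "m \<in> hom C X Y"
    and lift: "\<And>e u v K L. \<lbrakk>e \<in> Quot C; e \<in> hom C K L; u \<in> hom C K X; v \<in> hom C L Y; m \<cdot> u = v \<cdot> e\<rbrakk>
           \<Longrightarrow> \<exists>d \<in> hom C L X. d \<cdot> e = u \<and> m \<cdot> d = v"
  shows "m \<in> Emb C"
proof -
  have "has_lifting C e m" if "e \<in> Quot C" for e
    unfolding has_lifting_def using lift[OF that, of "Dom C e" "Cod C e"] m that Quot_eq
    by (auto simp: hom_def)
  then show ?thesis using m Emb_eq by (auto simp: hom_def)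
qed

lemma Emb_lift:
  assumes "m \<in> Emb C" "e \<in> Quot C" "m \<in> hom C X Y" "e \<in> hom C K L"
    "u \<in> hom C K X" "v \<in> hom C L Y" "m \<cdot> u = v \<cdot> e"
  obtains d where "d \<in> hom C L X" "d \<cdot> e = u" "m \<cdot> d = v"
proof -
  have "has_lifting C e m" using assms Emb_eq by auto
  then show thesis using that assms unfolding has_lifting_def by (auto simp: hom_def)
qed

lemma Quot_cancel:
  assumes "e \<in> Quot C" "e \<in> hom C K L" "u \<in> hom C L X" "v \<in> hom C L X" "u \<cdot> e = v \<cdot> e"
  shows "u = v"
  using Quot_epi[OF assms(1)] assms unfolding epi_arr_def by (metis homD)

text \<open>A square against \<open>g \<cdot> f\<close> is filled in two stages: first against
  \<open>g\<close>, then against \<open>f\<close> with the first filler as its bottom side.\<close>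

lemma Emb_Cmp:
  assumes "f \<in> Emb C" "g \<in> Emb C" "f \<in> hom C X Y" "g \<in> hom C Y Z"
  shows "g \<cdot> f \<in> Emb C"
proof (rule EmbI)
  show "g \<cdot> f \<in> hom C X Z" using Cmp_hom assms by blast
next
  fix e u v K L
  assume e: "e \<in> Quot C" "e \<in> hom C K L" and u: "u \<in> hom C K X" and v: "v \<in> hom C L Z"
    and sq: "(g \<cdot> f) \<cdot> u = v \<cdot> e"
  have fu: "f \<cdot> u \<in> hom C K Y" using Cmp_hom u assms by blast
  have "g \<cdot> f \<cdot> u = v \<cdot> e" using sq Cmp_assoc[OF u assms(3,4)] by simp
  then obtain d where d: "d \<in> hom C L Y" "d \<cdot> e = f \<cdot> u" "g \<cdot> d = v"
    using Emb_lift[OF assms(2) e(1) assms(4) e(2) fu v] by blast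
  obtain d' where d': "d' \<in> hom C L X" "d' \<cdot> e = u" "f \<cdot> d' = d"
    using Emb_lift[OF assms(1) e(1) assms(3) e(2) u d(1)] d(2) by metis
  have "(g \<cdot> f) \<cdot> d' = v" using Cmp_assoc[OF d'(1) assms(3,4)] d' d by simp
  then show "\<exists>d \<in> hom C L X. d \<cdot> e = u \<and> (g \<cdot> f) \<cdot> d = v" using d' by blast
qed

text \<open>Composing a square against \<open>f\<close> with \<open>g\<close> gives a square against
  \<open>g \<cdot> f\<close>, which has a filler \<open>d\<close>. The triangle
  \<open>f \<cdot> d = v\<close> holds after precomposition with the quotient \<open>e\<close>, and
  \<open>e\<close> is epic.\<close>

lemma Emb_right_factor:
  assumes "f \<in> hom C X Y" "g \<in> hom C Y Z" "g \<cdot> f \<in> Emb C"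
  shows "f \<in> Emb C"
proof (rule EmbI[OF assms(1)])
  fix e u v K L
  assume e: "e \<in> Quot C" "e \<in> hom C K L" and u: "u \<in> hom C K X" and v: "v \<in> hom C L Y"
    and sq: "f \<cdot> u = v \<cdot> e"
  have "(g \<cdot> f) \<cdot> u = (g \<cdot> v) \<cdot> e"
    using sq Cmp_assoc[OF u assms(1,2)] Cmp_assoc[OF e(2) v assms(2)] by simp
  then obtain d where d: "d \<in> hom C L X" "d \<cdot> e = u"
    using Emb_lift[OF assms(3) e(1) Cmp_hom[OF assms(1,2)] e(2) u Cmp_hom[OF v assms(2)]] by blast
  have "(f \<cdot> d) \<cdot> e = v \<cdot> e" using Cmp_assoc[OF e(2) d(1) assms(1)] d sq by simp
  then have "f \<cdot> d = v" using Quot_cancel[OF e Cmp_hom[OF d(1) assms(1)] v] by blast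
  then show "\<exists>d \<in> hom C L X. d \<cdot> e = u \<and> f \<cdot> d = v" using d by blast
qed

text \<open>In a square from a quotient \<open>e\<close> to \<open>q\<close>, the bottom side
  \<open>v\<close> equalises \<open>f\<close> and \<open>g\<close> because
  \<open>v \<cdot> e\<close> does and \<open>e\<close> is epic. So \<open>v\<close> factors through
  \<open>q\<close>, and uniqueness of factorisations gives the other triangle.\<close>

lemma equaliser_Emb:
  assumes f: "f \<in> hom C X Y" and g: "g \<in> hom C X Y" and q: "is_equaliser C f g q"
  shows "q \<in> Emb C"
proof -
  note qh = is_equaliserD(1)[OF q f] and eq = is_equaliserD(2)[OF q f]
    and univ = is_equaliserD(3)[OF q f]
  show ?thesis
  proof (rule EmbI[OF qh])
    fix e u v K L
    assume e: "e \<in> Quot C" "e \<in> hom C K L" and u: "u \<in> hom C K (Dom C q)" and v: "v \<in> hom C L X"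
      and sq: "q \<cdot> u = v \<cdot> e"
    have "(f \<cdot> v) \<cdot> e = (g \<cdot> v) \<cdot> e"
      using Cmp_assoc[OF e(2) v f] Cmp_assoc[OF e(2) v g] Cmp_assoc[OF u qh f] Cmp_assoc[OF u qh g] sq eq
      by simp
    then have "f \<cdot> v = g \<cdot> v"
      using Quot_cancel[OF e Cmp_hom[OF v f] Cmp_hom[OF v g]] by blast
    then obtain d where d: "d \<in> hom C L (Dom C q)" "q \<cdot> d = v"
      using univ[OF v] by blast
    have "q \<cdot> d \<cdot> e = q \<cdot> u" using Cmp_assoc[OF e(2) d(1) qh] d sq by simp
    moreover have "\<exists>!w. w \<in> hom C K (Dom C q) \<and> q \<cdot> w = q \<cdot> u"
      using univ[OF Cmp_hom[OF u qh]] Cmp_assoc[OF u qh f] Cmp_assoc[OF u qh g] eq by simp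
    ultimately have "d \<cdot> e = u" using Cmp_hom[OF e(2) d(1)] u by blast
    then show "\<exists>d \<in> hom C L (Dom C q). d \<cdot> e = u \<and> q \<cdot> d = v" using d by blast
  qed
qed

end

section \<open>Eilenberg-Moore categories and the cofree adjunction\<close>

lemma EM_simps [simp]:
  "Ob (EM C T P) = coalgebras C T" "Ar (EM C T P) = coalg_mors C T"
  "Dom (EM C T P) h = fst h" "Cod (EM C T P) h = snd (snd h)"
  "Id (EM C T P) a = (a, Id C (fst a), a)"
  "k \<cdot>\<^bsub>EM C T P\<^esub> h = (fst h, under k \<cdot>\<^bsub>C\<^esub> under h, snd (snd k))"
  "Quot (EM C T P) = {h \<in> coalg_mors C T. under h \<in> Quot C}"
  "Emb (EM C T P) = {h \<in> coalg_mors C T. under h \<in> Emb C}"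
  "Paths (EM C T P) = P"
  by (simp_all add: EM_def)

lemma EM_hom_iff:
  "h \<in> hom (EM C T P) a b \<longleftrightarrow>
     h = (a, under h, b) \<and> a \<in> coalgebras C T \<and> b \<in> coalgebras C T \<and>
     under h \<in> hom C (fst a) (fst b) \<and> snd b \<cdot>\<^bsub>C\<^esub> under h = amap T (under h) \<cdot>\<^bsub>C\<^esub> snd a"
  by (cases h; cases a; cases b) (auto simp: hom_def coalg_mors_def)

lemma EM_hom_underD:
  assumes "h \<in> hom (EM C T P) a b"
  shows "under h \<in> hom C (fst a) (fst b)" "a \<in> coalgebras C T" "b \<in> coalgebras C T"
    "snd b \<cdot>\<^bsub>C\<^esub> under h = amap T (under h) \<cdot>\<^bsub>C\<^esub> snd a" "fst h = a" "snd (snd h) = b"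
  using assms EM_hom_iff[of h C T P a b] by (auto simp: prod_eq_iff)

lemma coalgebrasD:
  assumes "a \<in> coalgebras C T"
  shows "fst a \<in> Ob C" "snd a \<in> hom C (fst a) (omap T (fst a))"
    "counit T (fst a) \<cdot>\<^bsub>C\<^esub> snd a = Id C (fst a)"
    "comult T (fst a) \<cdot>\<^bsub>C\<^esub> snd a = amap T (snd a) \<cdot>\<^bsub>C\<^esub> snd a"
  using assms by (auto simp: coalgebras_def)

lemma EM_Emb_iff:
  "h \<in> hom (EM C T P) a b \<Longrightarrow> h \<in> Emb (EM C T P) \<longleftrightarrow> under h \<in> Emb C"
  by (simp add: hom_def)

context comonad
begin

lemmas T_Ob = counit.F.omap_Ob
  and T_hom = counit.F.amap_hom
  and T_Cmp = counit.F.amap_Cmp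

lemma counit_hom: "X \<in> Ob C \<Longrightarrow> counit T X \<in> hom C (omap T X) X"
  using counit.component_hom by (simp add: id_func_def)

lemma comult_hom: "X \<in> Ob C \<Longrightarrow> comult T X \<in> hom C (omap T X) (omap T (omap T X))"
  using comult.component_hom by (simp add: comp_func_def)

lemma counit_nat: "f \<in> hom C X Y \<Longrightarrow> counit T Y \<cdot> amap T f = f \<cdot> counit T X"
  using counit.naturality by (simp add: id_func_def)

lemma comult_nat: "f \<in> hom C X Y \<Longrightarrow> comult T Y \<cdot> amap T f = amap T (amap T f) \<cdot> comult T X"
  using comult.naturality by (simp add: comp_func_def)

lemma hom_Ob: "f \<in> hom C X Y \<Longrightarrow> X \<in> Ob C \<and> Y \<in> Ob C"
  using counit.F.source.Dom_Ob counit.F.source.Cod_Ob by (auto simp: hom_def)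

lemma cofree_coalgebra: "X \<in> Ob C \<Longrightarrow> cofree T X \<in> coalgebras C T"
  by (simp add: cofree_def coalgebras_def T_Ob comult_hom counit_left coassoc)

end

locale fact_comonad = proper_fact_category C + comonad C T
  for C :: "('o, 'm, 'y) fact_cat_scheme" (structure)
    and T :: "('o, 'm, 'z) comonad_data_scheme"
begin

text \<open>The adjunct of \<open>h\<close> under the adjunction between the forgetful functor and
  the cofree functor. Composition with the counit is inverse to it, as
  \<open>counit_transpose\<close> and \<open>transpose_counit\<close> show.\<close>

definition transpose :: "('o, 'm) coalg \<Rightarrow> 'o \<Rightarrow> 'm \<Rightarrow> ('o, 'm) coalg_mor" where
  "transpose a X h = (a, amap T h \<cdot> snd a, cofree T X)"

text \<open>Naturality of the comultiplication moves it past \<open>amap T h\<close>, where the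
  coassociativity law of the coalgebra \<open>a\<close> applies.\<close>

lemma transpose_hom:
  assumes a: "a \<in> coalgebras C T" and h: "h \<in> hom C (fst a) X"
  shows "transpose a X h \<in> hom (EM C T P) a (cofree T X)"
proof -
  note a' = coalgebrasD[OF a]
  have X: "X \<in> Ob C" using hom_Ob h by blast
  note hs = a'(2) h T_hom[OF h] T_hom[OF T_hom[OF h]] T_hom[OF a'(2)] comult_hom[OF X] comult_hom[OF a'(1)]
  note ss = cat_simps hs[THEN homD]
  have "comult T X \<cdot> amap T h \<cdot> snd a = (comult T X \<cdot> amap T h) \<cdot> snd a" by (simp add: ss)
  also have "\<dots> = amap T (amap T h) \<cdot> comult T (fst a) \<cdot> snd a"
    unfolding comult_nat[OF h] by (simp add: ss)
  also have "\<dots> = (amap T (amap T h) \<cdot> amap T (snd a)) \<cdot> snd a"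
    unfolding a'(4) by (simp add: ss)
  also have "\<dots> = amap T (amap T h \<cdot> snd a) \<cdot> snd a" using T_Cmp[OF a'(2) T_hom[OF h]] by simp
  finally show ?thesis
    using a cofree_coalgebra[OF X] Cmp_hom[OF a'(2) T_hom[OF h]]
    by (simp add: EM_hom_iff transpose_def cofree_def)
qed

lemma counit_transpose:
  assumes a: "a \<in> coalgebras C T" and h: "h \<in> hom C (fst a) X"
  shows "counit T X \<cdot> under (transpose a X h) = h"
proof -
  note a' = coalgebrasD[OF a]
  have X: "X \<in> Ob C" using hom_Ob h by blast
  note hs = a'(2) h T_hom[OF h] counit_hom[OF X] counit_hom[OF a'(1)]
  note ss = cat_simps hs[THEN homD]
  have "counit T X \<cdot> amap T h \<cdot> snd a = (counit T X \<cdot> amap T h) \<cdot> snd a" by (simp add: ss)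
  also have "\<dots> = h \<cdot> counit T (fst a) \<cdot> snd a"
    unfolding counit_nat[OF h] by (simp add: ss)
  also have "\<dots> = h" unfolding a'(3) by (simp add: ss)
  finally show ?thesis by (simp add: transpose_def)
qed

text \<open>Since \<open>m\<close> is a coalgebra morphism,
  \<open>amap T (under m) \<cdot> snd a\<close> equals \<open>comult T X \<cdot> under m\<close>,
  and the law \<open>counit_right\<close> cancels the comultiplication.\<close>

lemma transpose_counit:
  assumes m: "m \<in> hom (EM C T P) a (cofree T X)" and X: "X \<in> Ob C"
  shows "transpose a X (counit T X \<cdot> under m) = m"
proof -
  note m' = EM_hom_underD[OF m]
  note a' = coalgebrasD[OF m'(2)]
  have mh: "under m \<in> hom C (fst a) (omap T X)" using m'(1) by (simp add: cofree_def)
  note hs = a'(2) mh T_hom[OF mh] T_hom[OF counit_hom[OF X]] comult_hom[OF X]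
  note ss = cat_simps hs[THEN homD]
  have "amap T (counit T X \<cdot> under m) \<cdot> snd a = amap T (counit T X) \<cdot> amap T (under m) \<cdot> snd a"
    unfolding T_Cmp[OF mh counit_hom[OF X]] by (simp add: ss)
  also have "\<dots> = amap T (counit T X) \<cdot> comult T X \<cdot> under m"
    using m'(4) by (simp add: cofree_def)
  also have "\<dots> = (amap T (counit T X) \<cdot> comult T X) \<cdot> under m" by (simp add: ss)
  also have "\<dots> = under m" unfolding counit_right[OF X] by (simp add: ss)
  finally show ?thesis using m'(5,6) by (simp add: transpose_def prod_eq_iff)
qed

text \<open>This is naturality of the adjunction in the coalgebra; it follows from the
  coalgebra-morphism square of \<open>p\<close>.\<close>

lemma transpose_Cmp:
  assumes p: "p \<in> hom (EM C T P) a b" and h: "h \<in> hom C (fst b) X"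
  shows "transpose b X h \<cdot>\<^bsub>EM C T P\<^esub> p = transpose a X (h \<cdot> under p)"
proof -
  note p' = EM_hom_underD[OF p]
  note hs = coalgebrasD(2)[OF p'(2)] coalgebrasD(2)[OF p'(3)] p'(1) h T_hom[OF p'(1)] T_hom[OF h]
  note ss = cat_simps hs[THEN homD]
  have "(amap T h \<cdot> snd b) \<cdot> under p = amap T h \<cdot> amap T (under p) \<cdot> snd a"
    using p'(4) by (simp add: ss)
  also have "\<dots> = amap T (h \<cdot> under p) \<cdot> snd a"
    unfolding T_Cmp[OF p'(1) h] by (simp add: ss)
  finally show ?thesis using p'(5) by (simp add: transpose_def)
qed

end

section \<open>The functor \<open>H\<close> and the Kleisli law on families\<close>

locale kleisli_setting =
  D: proper_fact_category D +
  S: comonad D S +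
  H: cat_functor "prod_cat I C" D H +
  kleisli_law I C T D S H \<kappa>
  for I :: "'i set"
    and C :: "'i \<Rightarrow> ('o, 'm, 'u) fact_cat_scheme"
    and T :: "'i \<Rightarrow> ('o, 'm, 'v) comonad_data_scheme"
    and P :: "'i \<Rightarrow> ('o, 'm) coalg set"
    and D :: "('p, 'q, 'w) fact_cat_scheme" (structure)
    and S :: "('p, 'q, 'x) comonad_data_scheme"
    and R :: "('p, 'q) coalg set"
    and H :: "('i \<Rightarrow> 'o, 'i \<Rightarrow> 'm, 'p, 'q, 'y) func_scheme"
    and \<kappa> :: "('i \<Rightarrow> 'o) \<Rightarrow> 'q" +
  assumes comonad_C: "i \<in> I \<Longrightarrow> comonad (C i) (T i)"
    and comonad_C_emb: "i \<in> I \<Longrightarrow> comonad_preserves_emb (C i) (T i)"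
    and comonad_D_emb: "comonad_preserves_emb D S"
    and EM_C: "i \<in> I \<Longrightarrow> path_category (EM (C i) (T i) (P i))"
    and EM_D: "path_category (EM D S R)"
    and EM_D_eq: "has_equalisers (EM D S R)"
    and H_emb: "functor_preserves_emb I C D H"
    and S2': "axiom_S2' I C T P D S R H \<kappa>"
begin

sublocale S: fact_comonad D S ..

text \<open>Objects and arrows of the product category are extensional. With the restriction built
  into \<open>Hob\<close>, \<open>Har\<close> and \<open>kap\<close>, families can be written as
  plain functions and matter only through their values on \<open>I\<close>.\<close>

definition Hob :: "('i \<Rightarrow> 'o) \<Rightarrow> 'p" where "Hob X = omap H (\<lambda>i\<in>I. X i)"

definition Har :: "('i \<Rightarrow> 'm) \<Rightarrow> 'q" where "Har f = amap H (\<lambda>i\<in>I. f i)"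

definition kap :: "('i \<Rightarrow> 'o) \<Rightarrow> 'q" where "kap X = \<kappa> (\<lambda>i\<in>I. X i)"

abbreviation bim :: "('p, 'q) coalg \<Rightarrow> ('i \<Rightarrow> ('o, 'm) coalg) \<Rightarrow> 'q \<Rightarrow> bool" where
  "bim \<equiv> bimorphism I D S H \<kappa>"

abbreviation ED :: "(('p, 'q) coalg, ('p, 'q) coalg_mor) path_cat" where "ED \<equiv> EM D S R"

abbreviation EC :: "'i \<Rightarrow> (('o, 'm) coalg, ('o, 'm) coalg_mor) path_cat" where
  "EC i \<equiv> EM (C i) (T i) (P i)"

lemma prod_hom:
  "(\<And>i. i \<in> I \<Longrightarrow> f i \<in> hom (C i) (X i) (Y i)) \<Longrightarrow>
     (\<lambda>i\<in>I. f i) \<in> hom (prod_cat I C) (\<lambda>i\<in>I. X i) (\<lambda>i\<in>I. Y i)"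
  by (auto simp: hom_def prod_cat_def restrict_def)

lemma prod_Ob: "(\<And>i. i \<in> I \<Longrightarrow> X i \<in> Ob (C i)) \<Longrightarrow> (\<lambda>i\<in>I. X i) \<in> Ob (prod_cat I C)"
  by (auto simp: prod_cat_def)

lemma Hob_Ob: "(\<And>i. i \<in> I \<Longrightarrow> X i \<in> Ob (C i)) \<Longrightarrow> Hob X \<in> Ob D"
  unfolding Hob_def using H.omap_Ob prod_Ob by blast

lemma Har_hom:
  "(\<And>i. i \<in> I \<Longrightarrow> f i \<in> hom (C i) (X i) (Y i)) \<Longrightarrow> Har f \<in> hom D (Hob X) (Hob Y)"
  unfolding Hob_def Har_def using H.amap_hom prod_hom by blast

lemma Har_Cmp:
  assumes "\<And>i. i \<in> I \<Longrightarrow> f i \<in> hom (C i) (X i) (Y i)"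
    and "\<And>i. i \<in> I \<Longrightarrow> g i \<in> hom (C i) (Y i) (Z i)"
  shows "Har (\<lambda>i. g i \<cdot>\<^bsub>C i\<^esub> f i) = Har g \<cdot> Har f"
proof -
  have "(\<lambda>i\<in>I. g i) \<cdot>\<^bsub>prod_cat I C\<^esub> (\<lambda>i\<in>I. f i) = (\<lambda>i\<in>I. g i \<cdot>\<^bsub>C i\<^esub> f i)"
    by (auto simp: prod_cat_def)
  then show ?thesis using H.amap_Cmp[OF prod_hom[OF assms(1)] prod_hom[OF assms(2)]] by (simp add: Har_def)
qed

lemma Har_Id:
  assumes "\<And>i. i \<in> I \<Longrightarrow> X i \<in> Ob (C i)"
  shows "Har (\<lambda>i. Id (C i) (X i)) = Id D (Hob X)"
proof -
  have "Id (prod_cat I C) (\<lambda>i\<in>I. X i) = (\<lambda>i\<in>I. Id (C i) (X i))"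
    by (auto simp: prod_cat_def)
  then show ?thesis using H.amap_Id[OF prod_Ob[OF assms]] by (simp add: Har_def Hob_def)
qed

lemma Har_Emb: "(\<And>i. i \<in> I \<Longrightarrow> f i \<in> Emb (C i)) \<Longrightarrow> Har f \<in> Emb D"
  using H_emb unfolding Har_def functor_preserves_emb_def by auto

lemma Har_cong: "(\<And>i. i \<in> I \<Longrightarrow> f i = g i) \<Longrightarrow> Har f = Har g"
  by (simp add: Har_def Hob_def cong: restrict_cong)

lemma Hob_cong: "(\<And>i. i \<in> I \<Longrightarrow> X i = Y i) \<Longrightarrow> Hob X = Hob Y"
  by (simp add: Har_def Hob_def cong: restrict_cong)

lemma kap_hom:
  assumes "\<And>i. i \<in> I \<Longrightarrow> X i \<in> Ob (C i)"
  shows "kap X \<in> hom D (omap S (Hob X)) (Hob (\<lambda>i. omap (T i) (X i)))"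
proof -
  have "omap (prod_func I T) (\<lambda>i\<in>I. X i) = (\<lambda>i\<in>I. omap (T i) (X i))"
    by (auto simp: prod_func_def)
  then show ?thesis using component_hom[OF prod_Ob[OF assms]] by (simp add: comp_func_def Har_def Hob_def kap_def)
qed

lemma kap_nat:
  assumes "\<And>i. i \<in> I \<Longrightarrow> f i \<in> hom (C i) (X i) (Y i)"
  shows "kap Y \<cdot> amap S (Har f) = Har (\<lambda>i. amap (T i) (f i)) \<cdot> kap X"
proof -
  have "amap (prod_func I T) (\<lambda>i\<in>I. f i) = (\<lambda>i\<in>I. amap (T i) (f i))"
    by (auto simp: prod_func_def)
  then show ?thesis using naturality[OF prod_hom[OF assms]] by (simp add: comp_func_def Har_def Hob_def kap_def)
qed

lemma kap_counit:
  assumes "\<And>i. i \<in> I \<Longrightarrow> X i \<in> Ob (C i)"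
  shows "Har (\<lambda>i. counit (T i) (X i)) \<cdot> kap X = counit S (Hob X)"
proof -
  have "(\<lambda>i\<in>I. counit (T i) ((\<lambda>i\<in>I. X i) i)) = (\<lambda>i\<in>I. counit (T i) (X i))" by auto
  then show ?thesis using K1[OF prod_Ob[OF assms]] by (simp add: Har_def Hob_def kap_def)
qed

lemma kap_comult:
  assumes "\<And>i. i \<in> I \<Longrightarrow> X i \<in> Ob (C i)"
  shows "Har (\<lambda>i. comult (T i) (X i)) \<cdot> kap X =
    kap (\<lambda>i. omap (T i) (X i)) \<cdot> amap S (kap X) \<cdot> comult S (Hob X)"
proof -
  have "(\<lambda>i\<in>I. comult (T i) ((\<lambda>i\<in>I. X i) i)) = (\<lambda>i\<in>I. comult (T i) (X i))" by auto
  moreover have "omap (prod_func I T) (\<lambda>i\<in>I. X i) = (\<lambda>i\<in>I. omap (T i) (X i))"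
    by (auto simp: prod_func_def)
  ultimately show ?thesis using K2[OF prod_Ob[OF assms]] by (simp add: Har_def Hob_def kap_def)
qed

lemma T_hom: "i \<in> I \<Longrightarrow> f \<in> hom (C i) X Y \<Longrightarrow> amap (T i) f \<in> hom (C i) (omap (T i) X) (omap (T i) Y)"
  using comonad.T_hom[OF comonad_C] .

lemma T_Ob: "i \<in> I \<Longrightarrow> X \<in> Ob (C i) \<Longrightarrow> omap (T i) X \<in> Ob (C i)"
  using comonad.T_Ob[OF comonad_C] .

lemma T_Emb: "i \<in> I \<Longrightarrow> f \<in> Emb (C i) \<Longrightarrow> amap (T i) f \<in> Emb (C i)"
  using comonad_C_emb unfolding comonad_preserves_emb_def by auto

lemma Emb_left_cancel:
  assumes "m \<in> Emb D" "m \<in> hom D Y Z" "u \<in> hom D X Y" "v \<in> hom D X Y" "m \<cdot> u = m \<cdot> v"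
  shows "u = v"
  using D.mono_cancel[OF D.Emb_mono[OF assms(1)] assms(2-5)] .

section \<open>Bimorphisms and coalgebra morphisms\<close>

lemma bim_iff:
  "bim a b g \<longleftrightarrow> g \<in> hom D (fst a) (Hob (\<lambda>i. fst (b i))) \<and>
     Har (\<lambda>i. snd (b i)) \<cdot> g = kap (\<lambda>i. fst (b i)) \<cdot> amap S g \<cdot> snd a"
  by (simp add: bimorphism_def Har_def Hob_def kap_def)

lemma bim_hom: "bim a b g \<Longrightarrow> g \<in> hom D (fst a) (Hob (\<lambda>i. fst (b i)))"
  by (simp add: bimorphism_def Har_def Hob_def kap_def)

text \<open>The coalgebra-morphism square of \<open>h\<close> turns
  \<open>snd a \<cdot> under h\<close> into \<open>amap S (under h) \<cdot> snd a'\<close>, and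
  functoriality of \<open>S\<close> absorbs the extra factor.\<close>

lemma bim_precomp:
  assumes g: "bim a b g" and h: "h \<in> hom ED a' a"
    and b: "\<And>i. i \<in> I \<Longrightarrow> b i \<in> coalgebras (C i) (T i)"
  shows "bim a' b (g \<cdot> under h)"
proof -
  note h' = EM_hom_underD[OF h]
  note gh = bim_hom[OF g]
  have beta: "Har (\<lambda>i. snd (b i)) \<in> hom D (Hob (\<lambda>i. fst (b i))) (Hob (\<lambda>i. omap (T i) (fst (b i))))"
    by (rule Har_hom) (rule coalgebrasD[OF b])
  have k: "kap (\<lambda>i. fst (b i)) \<in> hom D (omap S (Hob (\<lambda>i. fst (b i)))) (Hob (\<lambda>i. omap (T i) (fst (b i))))"
    by (rule kap_hom) (rule coalgebrasD[OF b])
  note hs = coalgebrasD(2)[OF h'(2)] coalgebrasD(2)[OF h'(3)] h'(1) gh beta k S.T_hom[OF gh] S.T_hom[OF h'(1)]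
  note ss = D.cat_simps hs[THEN homD]
  have "Har (\<lambda>i. snd (b i)) \<cdot> g \<cdot> under h = (Har (\<lambda>i. snd (b i)) \<cdot> g) \<cdot> under h" by (simp add: ss)
  also have "\<dots> = kap (\<lambda>i. fst (b i)) \<cdot> amap S g \<cdot> snd a \<cdot> under h"
    using g unfolding bim_iff by (simp add: ss)
  also have "\<dots> = kap (\<lambda>i. fst (b i)) \<cdot> (amap S g \<cdot> amap S (under h)) \<cdot> snd a'"
    unfolding h'(4) by (simp add: ss)
  also have "amap S g \<cdot> amap S (under h) = amap S (g \<cdot> under h)"
    using S.T_Cmp[OF h'(1) gh] by simp
  finally show ?thesis using D.Cmp_hom[OF h'(1) gh] by (simp add: bim_iff)
qed

lemma under_hom: "h \<in> hom (EM C' T' P') a b \<Longrightarrow> under h \<in> hom C' (fst a) (fst b)"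
  by (rule EM_hom_underD)

lemma Har_square:
  assumes k: "\<And>i. i \<in> I \<Longrightarrow> k i \<in> hom (EC i) (b i) (c i)"
  shows "Har (\<lambda>i. snd (c i)) \<cdot> Har (\<lambda>i. under (k i)) =
    Har (\<lambda>i. amap (T i) (under (k i))) \<cdot> Har (\<lambda>i. snd (b i))"
proof -
  have "Har (\<lambda>i. snd (c i) \<cdot>\<^bsub>C i\<^esub> under (k i)) = Har (\<lambda>i. amap (T i) (under (k i)) \<cdot>\<^bsub>C i\<^esub> snd (b i))"
    by (rule Har_cong) (rule EM_hom_underD[OF k])
  moreover have "Har (\<lambda>i. snd (c i) \<cdot>\<^bsub>C i\<^esub> under (k i)) = Har (\<lambda>i. snd (c i)) \<cdot> Har (\<lambda>i. under (k i))"
    by (rule Har_Cmp[OF under_hom[OF k] coalgebrasD(2)[OF EM_hom_underD(3)[OF k]]])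
  moreover have "Har (\<lambda>i. amap (T i) (under (k i)) \<cdot>\<^bsub>C i\<^esub> snd (b i)) =
      Har (\<lambda>i. amap (T i) (under (k i))) \<cdot> Har (\<lambda>i. snd (b i))"
    by (rule Har_Cmp[OF coalgebrasD(2)[OF EM_hom_underD(2)[OF k]] T_hom[OF _ under_hom[OF k]]])
  ultimately show ?thesis by simp
qed

text \<open>The two sides of the bimorphism equation for \<open>H(k) \<cdot> g\<close> are the two
  sides for \<open>g\<close> composed with \<open>H(T k)\<close>: on the left by the
  coalgebra-morphism squares of the \<open>k i\<close>, on the right by naturality of \<kappa>. If
  all \<open>k i\<close> are embeddings then so is \<open>H(T k)\<close>, because the comonads and
  \<open>H\<close> preserve embeddings; it is therefore monic and can be cancelled, which gives the
  reflection.\<close>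

lemma
  assumes a: "a \<in> coalgebras D S"
    and k: "\<And>i. i \<in> I \<Longrightarrow> k i \<in> hom (EC i) (b i) (c i)"
  shows bim_postcomp: "bim a b g \<Longrightarrow> bim a c (Har (\<lambda>i. under (k i)) \<cdot> g)"
    and bim_reflect: "\<lbrakk>\<And>i. i \<in> I \<Longrightarrow> k i \<in> Emb (EC i); g \<in> hom D (fst a) (Hob (\<lambda>i. fst (b i)));
      bim a c (Har (\<lambda>i. under (k i)) \<cdot> g)\<rbrakk> \<Longrightarrow> bim a b g"
proof -
  let ?B = "Hob (\<lambda>i. fst (b i))" and ?Cc = "Hob (\<lambda>i. fst (c i))"
    and ?TB = "Hob (\<lambda>i. omap (T i) (fst (b i)))" and ?TC = "Hob (\<lambda>i. omap (T i) (fst (c i)))"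
    and ?k = "Har (\<lambda>i. under (k i))" and ?Tk = "Har (\<lambda>i. amap (T i) (under (k i)))"
  note a' = coalgebrasD[OF a]
  note b' = coalgebrasD[OF EM_hom_underD(2)[OF k]] and c' = coalgebrasD[OF EM_hom_underD(3)[OF k]]
  have kh: "?k \<in> hom D ?B ?Cc" by (rule Har_hom[OF under_hom[OF k]])
  have Tkh: "?Tk \<in> hom D ?TB ?TC" by (rule Har_hom[OF T_hom[OF _ under_hom[OF k]]])
  have beta: "Har (\<lambda>i. snd (b i)) \<in> hom D ?B ?TB" by (rule Har_hom) (rule b')
  have gam: "Har (\<lambda>i. snd (c i)) \<in> hom D ?Cc ?TC" by (rule Har_hom) (rule c')
  have kb: "kap (\<lambda>i. fst (b i)) \<in> hom D (omap S ?B) ?TB" by (rule kap_hom) (rule b')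
  have kc: "kap (\<lambda>i. fst (c i)) \<in> hom D (omap S ?Cc) ?TC" by (rule kap_hom) (rule c')
  have main: "Har (\<lambda>i. snd (c i)) \<cdot> ?k \<cdot> g = ?Tk \<cdot> Har (\<lambda>i. snd (b i)) \<cdot> g"
    "kap (\<lambda>i. fst (c i)) \<cdot> amap S (?k \<cdot> g) \<cdot> snd a
       = ?Tk \<cdot> kap (\<lambda>i. fst (b i)) \<cdot> amap S g \<cdot> snd a"
    if g: "g \<in> hom D (fst a) ?B"
  proof -
    note hs = a'(2) kh Tkh beta gam kb kc g S.T_hom[OF g] S.T_hom[OF kh]
    note ss = D.cat_simps hs[THEN homD]
    show "Har (\<lambda>i. snd (c i)) \<cdot> ?k \<cdot> g = ?Tk \<cdot> Har (\<lambda>i. snd (b i)) \<cdot> g"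
      using D.Cmp_eq_extend[OF Har_square[OF k] kh gam g] by (simp add: ss)
    have "kap (\<lambda>i. fst (c i)) \<cdot> amap S (?k \<cdot> g) \<cdot> snd a
        = (kap (\<lambda>i. fst (c i)) \<cdot> amap S ?k) \<cdot> amap S g \<cdot> snd a"
      unfolding S.T_Cmp[OF g kh] by (simp add: ss)
    also have "kap (\<lambda>i. fst (c i)) \<cdot> amap S ?k = ?Tk \<cdot> kap (\<lambda>i. fst (b i))"
      by (rule kap_nat[OF under_hom[OF k]])
    also have "(?Tk \<cdot> kap (\<lambda>i. fst (b i))) \<cdot> amap S g \<cdot> snd a =
        ?Tk \<cdot> kap (\<lambda>i. fst (b i)) \<cdot> amap S g \<cdot> snd a"
      by (simp add: ss)
    finally show "kap (\<lambda>i. fst (c i)) \<cdot> amap S (?k \<cdot> g) \<cdot> snd a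
       = ?Tk \<cdot> kap (\<lambda>i. fst (b i)) \<cdot> amap S g \<cdot> snd a" .
  qed
  show "bim a b g \<Longrightarrow> bim a c (?k \<cdot> g)"
    using main D.Cmp_hom[OF _ kh] unfolding bim_iff by simp
  assume kE: "\<And>i. i \<in> I \<Longrightarrow> k i \<in> Emb (EC i)" and g: "g \<in> hom D (fst a) ?B"
    and bc: "bim a c (?k \<cdot> g)"
  have "?Tk \<in> Emb D" using kE by (intro Har_Emb T_Emb) simp_all
  moreover have "?Tk \<cdot> Har (\<lambda>i. snd (b i)) \<cdot> g = ?Tk \<cdot> kap (\<lambda>i. fst (b i)) \<cdot> amap S g \<cdot> snd a"
    using bc main[OF g] unfolding bim_iff by simp
  ultimately have "Har (\<lambda>i. snd (b i)) \<cdot> g = kap (\<lambda>i. fst (b i)) \<cdot> amap S g \<cdot> snd a"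
    using Emb_left_cancel[OF _ Tkh D.Cmp_hom[OF g beta]
        D.Cmp_hom[OF D.Cmp_hom[OF a'(2) S.T_hom[OF g]] kb]] by blast
  then show "bim a b g" using g by (simp add: bim_iff)
qed

section \<open>Bimorphisms into cofree coalgebras and the universal bimorphism\<close>

abbreviation cof :: "('i \<Rightarrow> 'o) \<Rightarrow> 'i \<Rightarrow> ('o, 'm) coalg" where "cof X \<equiv> \<lambda>i. cofree (T i) (X i)"

text \<open>One half of a bijection between arrows from \<open>fst a\<close> to \<open>H(X)\<close>
  and bimorphisms from \<open>a\<close> into the cofree coalgebras on the \<open>X i\<close>. The
  bimorphism equation comes from (K2), and (K1) shows that composing with the counits recovers
  \<open>h\<close>.\<close>

lemma
  assumes a: "a \<in> coalgebras D S" and X: "\<And>i. i \<in> I \<Longrightarrow> X i \<in> Ob (C i)"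
    and h: "h \<in> hom D (fst a) (Hob X)"
  shows bim_cofree: "bim a (cof X) (kap X \<cdot> amap S h \<cdot> snd a)"
    and counit_bim_cofree: "Har (\<lambda>i. counit (T i) (X i)) \<cdot> kap X \<cdot> amap S h \<cdot> snd a = h"
proof -
  note a' = coalgebrasD[OF a]
  let ?TX = "\<lambda>i. omap (T i) (X i)"
  let ?d = "Har (\<lambda>i. comult (T i) (X i))"
  have d: "?d \<in> hom D (Hob ?TX) (Hob (\<lambda>i. omap (T i) (?TX i)))"
    using comonad.comult_hom[OF comonad_C X] by (rule Har_hom)
  have e: "Har (\<lambda>i. counit (T i) (X i)) \<in> hom D (Hob ?TX) (Hob X)"
    using comonad.counit_hom[OF comonad_C X] by (rule Har_hom)
  have k: "kap X \<in> hom D (omap S (Hob X)) (Hob ?TX)" using X by (rule kap_hom)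
  have k2: "kap ?TX \<in> hom D (omap S (Hob ?TX)) (Hob (\<lambda>i. omap (T i) (?TX i)))"
    using T_Ob[OF _ X] by (rule kap_hom)
  have HX: "Hob X \<in> Ob D" using X by (rule Hob_Ob)
  note hs = a'(2) h d e k k2 S.T_hom[OF h] S.T_hom[OF S.T_hom[OF h]] S.T_hom[OF a'(2)] S.T_hom[OF k]
    S.comult_hom[OF HX] S.comult_hom[OF a'(1)] S.counit_hom[OF HX]
  note ss = D.cat_simps hs[THEN homD]
  have "?d \<cdot> kap X \<cdot> amap S h \<cdot> snd a = (?d \<cdot> kap X) \<cdot> amap S h \<cdot> snd a" by (simp add: ss)
  also have "\<dots> = kap ?TX \<cdot> amap S (kap X) \<cdot> comult S (Hob X) \<cdot> amap S h \<cdot> snd a"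
    using kap_comult[of X, OF X] by (simp add: ss)
  \<comment> \<open>This is the coalgebra-morphism square of the transpose of
    \<open>h\<close>.\<close>
  also have "comult S (Hob X) \<cdot> amap S h \<cdot> snd a = amap S (amap S h \<cdot> snd a) \<cdot> snd a"
    using EM_hom_underD(4)[OF S.transpose_hom[OF a h]] by (simp add: S.transpose_def cofree_def)
  also have "kap ?TX \<cdot> amap S (kap X) \<cdot> amap S (amap S h \<cdot> snd a) \<cdot> snd a =
      kap ?TX \<cdot> amap S (kap X \<cdot> amap S h \<cdot> snd a) \<cdot> snd a"
    using S.T_Cmp[OF D.Cmp_hom[OF a'(2) S.T_hom[OF h]] k] S.T_hom[OF D.Cmp_hom[OF a'(2) S.T_hom[OF h]], THEN homD]
    by (simp add: ss)
  finally show "bim a (cof X) (kap X \<cdot> amap S h \<cdot> snd a)"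
    using D.Cmp_hom[OF D.Cmp_hom[OF a'(2) S.T_hom[OF h]] k] by (simp add: bim_iff cofree_def)
  have "Har (\<lambda>i. counit (T i) (X i)) \<cdot> kap X \<cdot> amap S h \<cdot> snd a
      = (Har (\<lambda>i. counit (T i) (X i)) \<cdot> kap X) \<cdot> amap S h \<cdot> snd a" by (simp add: ss)
  also have "\<dots> = h"
    using S.counit_transpose[OF a h] kap_counit[of X, OF X] by (simp add: S.transpose_def)
  finally show "Har (\<lambda>i. counit (T i) (X i)) \<cdot> kap X \<cdot> amap S h \<cdot> snd a = h" .
qed

text \<open>The other half of the bijection. Naturality of \<kappa> at the counits produces
  \<open>kap ?TX \<cdot> amap S c \<cdot> snd a\<close>, which the bimorphism equation of
  \<open>c\<close> replaces by \<open>?d \<cdot> c\<close>; the counit laws of the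
  \<open>T i\<close> then cancel the comultiplications.\<close>

lemma bim_cofree_counit:
  assumes a: "a \<in> coalgebras D S" and X: "\<And>i. i \<in> I \<Longrightarrow> X i \<in> Ob (C i)"
    and c: "bim a (cof X) c"
  shows "kap X \<cdot> amap S (Har (\<lambda>i. counit (T i) (X i)) \<cdot> c) \<cdot> snd a = c"
proof -
  note a' = coalgebrasD[OF a]
  let ?TX = "\<lambda>i. omap (T i) (X i)"
  let ?d = "Har (\<lambda>i. comult (T i) (X i))" and ?e = "Har (\<lambda>i. counit (T i) (X i))"
    and ?Te = "Har (\<lambda>i. amap (T i) (counit (T i) (X i)))"
  have ch: "c \<in> hom D (fst a) (Hob ?TX)" using bim_hom[OF c] by (simp add: cofree_def)
  have d: "?d \<in> hom D (Hob ?TX) (Hob (\<lambda>i. omap (T i) (?TX i)))"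
    using comonad.comult_hom[OF comonad_C X] by (rule Har_hom)
  have e: "?e \<in> hom D (Hob ?TX) (Hob X)"
    using comonad.counit_hom[OF comonad_C X] by (rule Har_hom)
  have Te: "?Te \<in> hom D (Hob (\<lambda>i. omap (T i) (?TX i))) (Hob ?TX)"
    using T_hom[OF _ comonad.counit_hom[OF comonad_C X]] by (rule Har_hom)
  have k: "kap X \<in> hom D (omap S (Hob X)) (Hob ?TX)" using X by (rule kap_hom)
  have k2: "kap ?TX \<in> hom D (omap S (Hob ?TX)) (Hob (\<lambda>i. omap (T i) (?TX i)))"
    using T_Ob[OF _ X] by (rule kap_hom)
  have dk: "?Te \<cdot> ?d = Id D (Hob ?TX)"
  proof -
    have "?Te \<cdot> ?d = Har (\<lambda>i. amap (T i) (counit (T i) (X i)) \<cdot>\<^bsub>C i\<^esub> comult (T i) (X i))"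
      using Har_Cmp[OF comonad.comult_hom[OF comonad_C X] T_hom[OF _ comonad.counit_hom[OF comonad_C X]]]
      by simp
    also have "\<dots> = Har (\<lambda>i. Id (C i) (?TX i))"
      using comonad.counit_right[OF comonad_C X] by (rule Har_cong)
    also have "\<dots> = Id D (Hob ?TX)" using T_Ob[OF _ X] by (rule Har_Id)
    finally show ?thesis .
  qed
  note hs = a'(2) ch d e Te k k2 S.T_hom[OF ch] S.T_hom[OF e]
  note ss = D.cat_simps hs[THEN homD]
  have "kap X \<cdot> amap S (?e \<cdot> c) \<cdot> snd a = (kap X \<cdot> amap S ?e) \<cdot> amap S c \<cdot> snd a"
    unfolding S.T_Cmp[OF ch e] by (simp add: ss)
  also have "\<dots> = ?Te \<cdot> kap ?TX \<cdot> amap S c \<cdot> snd a"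
    using kap_nat[OF comonad.counit_hom[OF comonad_C X]] by (simp add: ss)
  also have "\<dots> = ?Te \<cdot> ?d \<cdot> c" using c by (simp add: bim_iff cofree_def)
  also have "\<dots> = (?Te \<cdot> ?d) \<cdot> c" by (simp add: ss)
  also have "\<dots> = c" unfolding dk by (simp add: ss)
  finally show ?thesis .
qed

text \<open>A bimorphism into cofree coalgebras is recovered from its composite with the counits, so
  equality may be tested there.\<close>

lemma bim_cofree_eqI:
  assumes a: "a \<in> coalgebras D S" and X: "\<And>i. i \<in> I \<Longrightarrow> X i \<in> Ob (C i)"
    and "bim a (cof X) c" "bim a (cof X) c'"
    and "Har (\<lambda>i. counit (T i) (X i)) \<cdot> c = Har (\<lambda>i. counit (T i) (X i)) \<cdot> c'"
  shows "c = c'"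
proof -
  have "c = kap X \<cdot> amap S (Har (\<lambda>i. counit (T i) (X i)) \<cdot> c) \<cdot> snd a"
    by (rule bim_cofree_counit[OF a X assms(3), symmetric])
  also have "\<dots> = c'"
    unfolding assms(5) by (rule bim_cofree_counit[OF a X assms(4)])
  finally show ?thesis .
qed

text \<open>The source of \<open>u\<close> is the equaliser of the two coalgebra morphisms
  \<open>F(H Z) \<rightarrow> F(H(T Z))\<close> that are transposes of \<open>H(\<zeta>) \<circ> \<epsilon>\<close> and of \<open>\<kappa>\<close>.\<close>

lemma universal_bimorphism:
  assumes z: "\<And>i. i \<in> I \<Longrightarrow> z i \<in> coalgebras (C i) (T i)"
  obtains w u where "w \<in> coalgebras D S" "bim w z u"
    "\<And>a b. \<lbrakk>a \<in> coalgebras D S; bim a z b\<rbrakk> \<Longrightarrow> \<exists>!p. p \<in> hom ED a w \<and> u \<cdot> under p = b"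
    "\<And>a p. \<lbrakk>p \<in> hom ED a w; p \<in> Emb ED\<rbrakk> \<Longrightarrow> amap S (u \<cdot> under p) \<cdot> snd a \<in> Emb D"
proof -
  interpret ED: path_category ED by (rule EM_D)
  let ?Z = "Hob (\<lambda>i. fst (z i))" and ?TZ = "Hob (\<lambda>i. omap (T i) (fst (z i)))"
  let ?FZ = "cofree S ?Z" and ?zeta = "Har (\<lambda>i. snd (z i))" and ?k = "kap (\<lambda>i. fst (z i))"
  let ?ep = "counit S ?Z"
  have Z: "?Z \<in> Ob D" by (rule Hob_Ob) (rule coalgebrasD[OF z])
  have TZ: "?TZ \<in> Ob D" by (rule Hob_Ob) (rule T_Ob[OF _ coalgebrasD(1)[OF z]])
  have FZ: "?FZ \<in> coalgebras D S" using S.cofree_coalgebra[OF Z] .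
  have zeta: "?zeta \<in> hom D ?Z ?TZ" by (rule Har_hom) (rule coalgebrasD[OF z])
  have k: "?k \<in> hom D (omap S ?Z) ?TZ" by (rule kap_hom) (rule coalgebrasD[OF z])
  have ep: "?ep \<in> hom D (omap S ?Z) ?Z" using S.counit_hom[OF Z] .
  have ze: "?zeta \<cdot> ?ep \<in> hom D (fst ?FZ) ?TZ" using D.Cmp_hom[OF ep zeta] by (simp add: cofree_def)
  have k': "?k \<in> hom D (fst ?FZ) ?TZ" using k by (simp add: cofree_def)
  let ?s = "S.transpose ?FZ ?TZ (?zeta \<cdot> ?ep)" and ?t = "S.transpose ?FZ ?TZ ?k"
  have s: "?s \<in> hom ED ?FZ (cofree S ?TZ)" using S.transpose_hom[OF FZ ze] .
  have t: "?t \<in> hom ED ?FZ (cofree S ?TZ)" using S.transpose_hom[OF FZ k'] .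
  \<comment> \<open>With \<open>b = ?ep \<cdot> under q\<close>, the morphism \<open>q\<close> is
    the transpose of \<open>b\<close>, so \<open>under q = amap S b \<cdot> snd a\<close>. Hence the
    composites of \<open>q\<close> with \<open>?s\<close> and \<open>?t\<close> are the transposes
    of the two sides of the bimorphism equation for \<open>b\<close>.\<close>
  have eqz: "?s \<cdot>\<^bsub>ED\<^esub> q = ?t \<cdot>\<^bsub>ED\<^esub> q \<longleftrightarrow> bim a z (?ep \<cdot> under q)"
    if q: "q \<in> hom ED a ?FZ" for a q
  proof -
    note q' = EM_hom_underD[OF q]
    have qh: "under q \<in> hom D (fst a) (omap S ?Z)" using q'(1) by (simp add: cofree_def)
    have inj: "x = y" if "x \<in> hom D (fst a) ?TZ" "y \<in> hom D (fst a) ?TZ"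
      "S.transpose a ?TZ x = S.transpose a ?TZ y" for x y
      by (rule trans[OF S.counit_transpose[OF q'(2) that(1), symmetric]])
        (unfold that(3), rule S.counit_transpose[OF q'(2) that(2)])
    have st: "?s \<cdot>\<^bsub>ED\<^esub> q = S.transpose a ?TZ ((?zeta \<cdot> ?ep) \<cdot> under q)"
      "?t \<cdot>\<^bsub>ED\<^esub> q = S.transpose a ?TZ (?k \<cdot> under q)"
      by (rule S.transpose_Cmp[OF q ze], rule S.transpose_Cmp[OF q k'])
    have "amap S (?ep \<cdot> under q) \<cdot> snd a = under q"
      using arg_cong[OF S.transpose_counit[OF q Z], of under] by (simp add: S.transpose_def)
    then have "bim a z (?ep \<cdot> under q) \<longleftrightarrow> (?zeta \<cdot> ?ep) \<cdot> under q = ?k \<cdot> under q"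
      unfolding bim_iff using D.Cmp_hom[OF qh ep] D.Cmp_assoc[OF qh ep zeta] by simp
    also have "\<dots> \<longleftrightarrow> ?s \<cdot>\<^bsub>ED\<^esub> q = ?t \<cdot>\<^bsub>ED\<^esub> q"
      unfolding st
      by (rule iffI, erule arg_cong)
        (rule inj[OF D.Cmp_hom[OF qh D.Cmp_hom[OF ep zeta]] D.Cmp_hom[OF qh k]])
    finally show ?thesis by simp
  qed
  obtain q where q: "is_equaliser ED ?s ?t q"
    using EM_D_eq s t unfolding has_equalisers_def by blast
  define w where "w = Dom ED q"
  define u where "u = ?ep \<cdot> under q"
  have qh: "q \<in> hom ED w ?FZ" and qeq: "?s \<cdot>\<^bsub>ED\<^esub> q = ?t \<cdot>\<^bsub>ED\<^esub> q"
    using is_equaliserD[OF q s] unfolding w_def by blast+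
  have univ: "\<exists>!p. p \<in> hom ED a w \<and> q \<cdot>\<^bsub>ED\<^esub> p = r"
    if "r \<in> hom ED a ?FZ" "?s \<cdot>\<^bsub>ED\<^esub> r = ?t \<cdot>\<^bsub>ED\<^esub> r" for a r
    using is_equaliserD(3)[OF q s that] unfolding w_def .
  note q' = EM_hom_underD[OF qh]
  have quh: "under q \<in> hom D (fst w) (omap S ?Z)" using q'(1) by (simp add: cofree_def)
  have uh: "u \<in> hom D (fst w) ?Z" unfolding u_def using D.Cmp_hom[OF quh ep] .
  have w: "w \<in> coalgebras D S" by (rule q')
  have bu: "bim w z u" using eqz[OF qh] qeq u_def by simp
  have qtr: "q = S.transpose w ?Z u" using S.transpose_counit[OF qh Z] u_def by simp
  have qp: "q \<cdot>\<^bsub>ED\<^esub> p = S.transpose a ?Z (u \<cdot> under p)" if p: "p \<in> hom ED a w" for a p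
    using S.transpose_Cmp[OF p uh] unfolding qtr[symmetric] .
  \<comment> \<open>The universal property of \<open>q\<close> is read through the adjunction: the
    transpose of a bimorphism \<open>b\<close> equalises \<open>?s\<close> and \<open>?t\<close>,
    and \<open>q\<close> is itself the transpose of \<open>u\<close>.\<close>
  have univ': "\<exists>!p. p \<in> hom ED a w \<and> u \<cdot> under p = b" if a: "a \<in> coalgebras D S" and b: "bim a z b" for a b
  proof -
    have bh: "b \<in> hom D (fst a) ?Z" using bim_hom[OF b] .
    have r: "S.transpose a ?Z b \<in> hom ED a ?FZ" using S.transpose_hom[OF a bh] .
    have "?s \<cdot>\<^bsub>ED\<^esub> S.transpose a ?Z b = ?t \<cdot>\<^bsub>ED\<^esub> S.transpose a ?Z b"
      using eqz[OF r] b S.counit_transpose[OF a bh] by simp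
    note ex = univ[OF r this]
    have tr: "q \<cdot>\<^bsub>ED\<^esub> p = S.transpose a ?Z b \<longleftrightarrow> u \<cdot> under p = b"
      if p: "p \<in> hom ED a w" for p
    proof -
      have "u \<cdot> under p \<in> hom D (fst a) ?Z" using D.Cmp_hom[OF EM_hom_underD(1)[OF p] uh] .
      then show ?thesis unfolding qp[OF p] using S.counit_transpose[OF a] bh by metis
    qed
    have "p \<in> hom ED a w \<and> q \<cdot>\<^bsub>ED\<^esub> p = S.transpose a ?Z b \<longleftrightarrow>
        p \<in> hom ED a w \<and> u \<cdot> under p = b" for p
      using tr by (intro conj_cong refl)
    then show ?thesis using ex by (simp only:)
  qed
  \<comment> \<open>The arrow in question underlies the composite of \<open>q\<close> and
    \<open>p\<close>, and \<open>q\<close> is an embedding because it is an equaliser.\<close>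
  have emb: "amap S (u \<cdot> under p) \<cdot> snd a \<in> Emb D" if p: "p \<in> hom ED a w" "p \<in> Emb ED" for a p
  proof -
    have "q \<cdot>\<^bsub>ED\<^esub> p \<in> Emb ED"
      using ED.Emb_Cmp[OF p(2) ED.equaliser_Emb[OF s t q] p(1) qh] .
    then show ?thesis unfolding qp[OF p(1)] by (simp add: S.transpose_def)
  qed
  show thesis using that[OF w bu univ' emb] .
qed

text \<open>By the bijection \<open>c = kap X \<cdot> amap S k \<cdot> snd a\<close>, so
  \<open>amap S c \<cdot> snd a\<close> factors as an arrow after
  \<open>amap S k \<cdot> snd a\<close>. A right factor of an embedding is an embedding.\<close>

lemma bim_cofree_Emb:
  assumes a: "a \<in> coalgebras D S" and X: "\<And>i. i \<in> I \<Longrightarrow> X i \<in> Ob (C i)"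
    and c: "bim a (cof X) c" and emb: "amap S c \<cdot> snd a \<in> Emb D"
    and k_def: "k = Har (\<lambda>i. counit (T i) (X i)) \<cdot> c"
  shows "amap S k \<cdot> snd a \<in> Emb D"
proof -
  note a' = coalgebrasD[OF a]
  let ?TX = "\<lambda>i. omap (T i) (X i)"
  have ch: "c \<in> hom D (fst a) (Hob ?TX)" using bim_hom[OF c] by (simp add: cofree_def)
  have e: "Har (\<lambda>i. counit (T i) (X i)) \<in> hom D (Hob ?TX) (Hob X)"
    using comonad.counit_hom[OF comonad_C X] by (rule Har_hom)
  have k: "k \<in> hom D (fst a) (Hob X)" unfolding k_def by (rule D.Cmp_hom[OF ch e])
  have kp: "kap X \<in> hom D (omap S (Hob X)) (Hob ?TX)" using X by (rule kap_hom)
  have HX: "Hob X \<in> Ob D" using X by (rule Hob_Ob)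
  have Ska: "amap S k \<cdot> snd a \<in> hom D (fst a) (omap S (Hob X))"
    by (rule D.Cmp_hom[OF a'(2) S.T_hom[OF k]])
  note hs = a'(2) Ska S.T_hom[OF Ska] S.T_hom[OF kp] S.comult_hom[OF HX]
  note ss = D.cat_simps hs[THEN homD]
  have "amap S c \<cdot> snd a = amap S (kap X \<cdot> amap S k \<cdot> snd a) \<cdot> snd a"
    using bim_cofree_counit[OF a X c] unfolding k_def by simp
  also have "\<dots> = amap S (kap X) \<cdot> amap S (amap S k \<cdot> snd a) \<cdot> snd a"
    unfolding S.T_Cmp[OF Ska kp] by (simp only: ss)
  also have "amap S (amap S k \<cdot> snd a) \<cdot> snd a = comult S (Hob X) \<cdot> amap S k \<cdot> snd a"
    using EM_hom_underD(4)[OF S.transpose_hom[OF a k]] by (simp add: S.transpose_def cofree_def)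
  also have "amap S (kap X) \<cdot> comult S (Hob X) \<cdot> amap S k \<cdot> snd a =
      (amap S (kap X) \<cdot> comult S (Hob X)) \<cdot> amap S k \<cdot> snd a"
    by (rule D.Cmp_assoc[OF Ska S.comult_hom[OF HX] S.T_hom[OF kp], symmetric])
  finally have "(amap S (kap X) \<cdot> comult S (Hob X)) \<cdot> amap S k \<cdot> snd a \<in> Emb D" using emb by simp
  then show ?thesis
    using D.Emb_right_factor[OF Ska D.Cmp_hom[OF S.comult_hom[OF HX] S.T_hom[OF kp]]] by blast
qed

section \<open>Path decompositions of bimorphisms\<close>

abbreviation HU :: "('i \<Rightarrow> ('o, 'm) coalg_mor) \<Rightarrow> 'q" where "HU k \<equiv> Har (\<lambda>i. under (k i))"

abbreviation UO :: "('i \<Rightarrow> ('o, 'm) coalg) \<Rightarrow> 'p" where "UO x \<equiv> Hob (\<lambda>i. fst (x i))"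

lemma HU_hom: "(\<And>i. i \<in> I \<Longrightarrow> k i \<in> hom (EC i) (x i) (y i)) \<Longrightarrow> HU k \<in> hom D (UO x) (UO y)"
  by (rule Har_hom) (rule under_hom)

lemma HU_Cmp:
  assumes "\<And>i. i \<in> I \<Longrightarrow> k i \<in> hom (EC i) (x i) (y i)"
    and "\<And>i. i \<in> I \<Longrightarrow> l i \<in> hom (EC i) (y i) (z i)"
    and "\<And>i. i \<in> I \<Longrightarrow> m i = l i \<cdot>\<^bsub>EC i\<^esub> k i"
  shows "HU m = HU l \<cdot> HU k"
proof -
  have "HU m = Har (\<lambda>i. under (l i) \<cdot>\<^bsub>C i\<^esub> under (k i))"
    using assms(3) by (intro Har_cong) simp
  also have "\<dots> = HU l \<cdot> HU k"
    by (rule Har_Cmp[OF under_hom[OF assms(1)] under_hom[OF assms(2)]])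
  finally show ?thesis .
qed

lemma HU_Emb: "(\<And>i. i \<in> I \<Longrightarrow> k i \<in> Emb (EC i)) \<Longrightarrow> HU k \<in> Emb D"
  by (rule Har_Emb) simp

text \<open>A form of \<open>decomposition\<close> in which the sources of the embeddings are an
  explicit family \<open>x\<close>, so that each component is typed by a hom set.\<close>

definition path_decomposition ::
  "('p, 'q) coalg \<Rightarrow> ('i \<Rightarrow> ('o, 'm) coalg) \<Rightarrow> 'q
     \<Rightarrow> ('i \<Rightarrow> ('o, 'm) coalg) \<Rightarrow> ('i \<Rightarrow> ('o, 'm) coalg_mor) \<Rightarrow> 'q \<Rightarrow> bool" where
  "path_decomposition a z b x e b0 \<longleftrightarrow>
     (\<forall>i\<in>I. e i \<in> hom (EC i) (x i) (z i) \<and> e i \<in> Emb (EC i) \<and> x i \<in> P i) \<and>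
     b0 \<in> hom D (fst a) (UO x) \<and> b = HU e \<cdot> b0"

lemma path_decompositionI:
  assumes "\<And>i. i \<in> I \<Longrightarrow> e i \<in> hom (EC i) (x i) (z i)" "\<And>i. i \<in> I \<Longrightarrow> e i \<in> Emb (EC i)"
    "\<And>i. i \<in> I \<Longrightarrow> x i \<in> P i" "b0 \<in> hom D (fst a) (UO x)" "b = HU e \<cdot> b0"
  shows "path_decomposition a z b x e b0"
  unfolding path_decomposition_def using assms by blast

lemma path_decompositionD:
  assumes "path_decomposition a z b x e b0"
  shows "i \<in> I \<Longrightarrow> e i \<in> hom (EC i) (x i) (z i)" "i \<in> I \<Longrightarrow> e i \<in> Emb (EC i)"
    "i \<in> I \<Longrightarrow> x i \<in> P i" "b0 \<in> hom D (fst a) (UO x)" "b = HU e \<cdot> b0"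
  using assms unfolding path_decomposition_def by blast+

lemma decomposition_of_path_decomposition:
  assumes "path_decomposition a z b y k k0"
  shows "decomposition I EC D H a z b k k0" "i \<in> I \<Longrightarrow> Dom (EC i) (k i) = y i"
proof -
  note k = path_decompositionD[OF assms]
  have Dk: "Dom (EC i) (k i) = y i" "Cod (EC i) (k i) = z i" if "i \<in> I" for i
    using homD[OF k(1)[OF that]] by simp_all
  show "i \<in> I \<Longrightarrow> Dom (EC i) (k i) = y i" by (rule Dk)
  have "UO (\<lambda>i. Dom (EC i) (k i)) = UO y" using Dk by (intro Hob_cong) simp
  then have "k0 \<in> hom D (fst a) (omap H (\<lambda>i\<in>I. fst (Dom (EC i) (k i))))"
    using k(4) unfolding Hob_def by simp
  moreover have "path_embedding (EC i) (k i) \<and> Cod (EC i) (k i) = z i" if "i \<in> I" for i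
    using Dk[OF that] k(2,3)[OF that] unfolding path_embedding_def EM_simps(9) by simp
  ultimately show "decomposition I EC D H a z b k k0"
    using k(5) unfolding decomposition_def Har_def by blast
qed

lemma path_decomposition_of_decomposition:
  assumes "decomposition I EC D H a z b k k0"
  shows "path_decomposition a z b (\<lambda>i. Dom (EC i) (k i)) k k0"
proof (rule path_decompositionI)
  show "k i \<in> Emb (EC i)" "Dom (EC i) (k i) \<in> P i" if "i \<in> I" for i
    using assms that unfolding decomposition_def path_embedding_def EM_simps(9) by blast+
  show "k0 \<in> hom D (fst a) (UO (\<lambda>i. Dom (EC i) (k i)))" "b = HU k \<cdot> k0"
    using assms unfolding decomposition_def Har_def Hob_def by blast+
  show "k i \<in> hom (EC i) (Dom (EC i) (k i)) (z i)" if i: "i \<in> I" for i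
  proof -
    have "k i \<in> Emb (EC i)" "Cod (EC i) (k i) = z i"
      using assms i unfolding decomposition_def path_embedding_def by blast+
    then show ?thesis by (simp add: hom_def)
  qed
qed

lemma minimal_path_decomposition:
  assumes a: "a \<in> R" and z: "\<And>i. i \<in> I \<Longrightarrow> z i \<in> coalgebras (C i) (T i)" and b: "bim a z b"
  obtains x e b0 where "path_decomposition a z b x e b0"
    "\<forall>y k k0. path_decomposition a z b y k k0 \<longrightarrow>
       (\<exists>h. \<forall>i\<in>I. h i \<in> hom (EC i) (x i) (y i) \<and> e i = k i \<cdot>\<^bsub>EC i\<^esub> h i)"
proof -
  have "a \<in> Paths ED" "\<forall>i\<in>I. z i \<in> Ob (EC i)" using a z by simp_all
  then obtain e b0 where dec: "decomposition I EC D H a z b e b0"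
    and mini: "\<And>g g0. decomposition I EC D H a z b g g0 \<Longrightarrow>
         \<exists>h. \<forall>i\<in>I. h i \<in> hom (EC i) (Dom (EC i) (e i)) (Dom (EC i) (g i)) \<and>
            e i = g i \<cdot>\<^bsub>EC i\<^esub> h i"
    using S2' b unfolding axiom_S2'_def Let_def by blast
  have mini': "\<exists>h. \<forall>i\<in>I. h i \<in> hom (EC i) (Dom (EC i) (e i)) (y i) \<and> e i = k i \<cdot>\<^bsub>EC i\<^esub> h i"
    if k: "path_decomposition a z b y k k0" for y k k0
    using mini[OF decomposition_of_path_decomposition(1)[OF k]] decomposition_of_path_decomposition(2)[OF k] by metis
  show thesis using mini' by (intro that[OF path_decomposition_of_decomposition[OF dec]]) blast
qed

section \<open>The comparison morphism is an open pathwise-embedding\<close>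

text \<open>The transpose below is the comparison \<open>W \<rightarrow> F(H(A))\<close> that \<open>f\<close> induces, where \<open>W\<close> is
  the source of the universal bimorphism \<open>u\<close>.\<close>

lemma open_pathwise_embedding_transpose:
  assumes z: "\<And>i. i \<in> I \<Longrightarrow> z i \<in> coalgebras (C i) (T i)"
    and A: "\<And>i. i \<in> I \<Longrightarrow> A i \<in> Ob (C i)"
    and f: "\<And>i. i \<in> I \<Longrightarrow> f i \<in> hom (EC i) (z i) (cof A i)"
    and fop: "\<And>i. i \<in> I \<Longrightarrow> open_pathwise_embedding (EC i) (f i)"
    and w: "w \<in> coalgebras D S" and u: "bim w z u"
    and univ: "\<And>a b. \<lbrakk>a \<in> coalgebras D S; bim a z b\<rbrakk> \<Longrightarrow> \<exists>!p. p \<in> hom ED a w \<and> u \<cdot> under p = b"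
    and emb: "\<And>a p. \<lbrakk>p \<in> hom ED a w; p \<in> Emb ED\<rbrakk> \<Longrightarrow> amap S (u \<cdot> under p) \<cdot> snd a \<in> Emb D"
    and phi_def: "phi = S.transpose w (Hob A) (Har (\<lambda>i. counit (T i) (A i)) \<cdot> HU f \<cdot> u)"
  shows "phi \<in> hom ED w (cofree S (Hob A))" "open_pathwise_embedding ED phi"
proof -
  interpret ED: path_category ED by (rule EM_D)
  let ?FA = "cofree S (Hob A)" and ?e = "Har (\<lambda>i. counit (T i) (A i))"
  have cA: "cof A i \<in> coalgebras (C i) (T i)" if "i \<in> I" for i
    using EM_hom_underD(3)[OF f[OF that]] .
  have HA: "Hob A \<in> Ob D" using A by (rule Hob_Ob)
  have e: "?e \<in> hom D (UO (cof A)) (Hob A)"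
    using Har_hom[OF comonad.counit_hom[OF comonad_C A]] by (simp add: cofree_def)
  have uh: "u \<in> hom D (fst w) (UO z)" using bim_hom[OF u] .
  have fh: "HU f \<in> hom D (UO z) (UO (cof A))" by (rule HU_hom) (rule f)
  have efu: "?e \<cdot> HU f \<cdot> u \<in> hom D (fst w) (Hob A)"
    by (rule D.Cmp_hom[OF D.Cmp_hom[OF uh fh] e])
  show phi: "phi \<in> hom ED w ?FA" unfolding phi_def using S.transpose_hom[OF w efu] .
  have phi_Cmp: "phi \<cdot>\<^bsub>ED\<^esub> p = S.transpose a (Hob A) (?e \<cdot> HU f \<cdot> u \<cdot> under p)"
    if p: "p \<in> hom ED a w" for a p
  proof -
    have "(?e \<cdot> HU f \<cdot> u) \<cdot> under p = ?e \<cdot> HU f \<cdot> u \<cdot> under p"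
      using D.Cmp_assoc[OF under_hom[OF p] D.Cmp_hom[OF uh fh] e] D.Cmp_assoc[OF under_hom[OF p] uh fh]
      by simp
    then show ?thesis using S.transpose_Cmp[OF p efu] unfolding phi_def by metis
  qed
  have fe: "f i \<cdot>\<^bsub>EC i\<^esub> e \<in> hom (EC i) x (cof A i)" "f i \<cdot>\<^bsub>EC i\<^esub> e \<in> Emb (EC i)"
    if i: "i \<in> I" and e: "e \<in> hom (EC i) x (z i)" "e \<in> Emb (EC i)" "x \<in> P i" for i e x
  proof -
    interpret EC: path_category "EC i" by (rule EM_C[OF i])
    show "f i \<cdot>\<^bsub>EC i\<^esub> e \<in> hom (EC i) x (cof A i)" by (rule EC.Cmp_hom[OF e(1) f[OF i]])
    have "path_embedding (EC i) e" using e by (intro path_embeddingI) simp_all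
    then show "f i \<cdot>\<^bsub>EC i\<^esub> e \<in> Emb (EC i)"
      using open_pathwise_embeddingD(1)[OF fop[OF i] f[OF i]] e(1) by blast
  qed
  have bp: "bim a z (u \<cdot> under p)" if "p \<in> hom ED a w" for a p
    by (rule bim_precomp[OF u that z])
  have pe: "phi \<cdot>\<^bsub>ED\<^esub> p \<in> Emb ED" if p: "p \<in> hom ED a w" and pE: "p \<in> Emb ED" and a: "a \<in> R" for a p
  proof -
    define b where "b = u \<cdot> under p"
    have ac: "a \<in> coalgebras D S" using EM_hom_underD(2)[OF p] .
    note a' = coalgebrasD[OF ac]
    have bb: "bim a z b" unfolding b_def by (rule bp[OF p])
    obtain x e' b0 where dec: "path_decomposition a z b x e' b0"
      using minimal_path_decomposition[OF a z bb] by metis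
    note ex = path_decompositionD(1-3)[OF dec] and b0 = path_decompositionD(4,5)[OF dec]
    define fe' where "fe' i = f i \<cdot>\<^bsub>EC i\<^esub> e' i" for i
    have feE: "fe' i \<in> hom (EC i) (x i) (cof A i)" "fe' i \<in> Emb (EC i)" if "i \<in> I" for i
      unfolding fe'_def by (rule fe[OF that ex[OF that]])+
    have eh: "HU e' \<in> hom D (UO x) (UO z)" by (rule HU_hom) (rule ex)
    have feh: "HU fe' \<in> hom D (UO x) (UO (cof A))" by (rule HU_hom) (rule feE)
    have Sb0: "amap S b0 \<cdot> snd a \<in> hom D (fst a) (omap S (UO x))"
      by (rule D.Cmp_hom[OF a'(2) S.T_hom[OF b0(1)]])
    \<comment> \<open>The assumption \<open>emb\<close> concerns the transpose
      \<open>amap S b \<cdot> snd a\<close>, so the argument runs on transposes: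
      \<open>amap S b0 \<cdot> snd a\<close> is a right factor of it.\<close>
    have "amap S (HU e') \<cdot> amap S b0 \<cdot> snd a = amap S b \<cdot> snd a"
      unfolding b0(2) S.T_Cmp[OF b0(1) eh]
      by (rule D.Cmp_assoc[OF a'(2) S.T_hom[OF b0(1)] S.T_hom[OF eh], symmetric])
    also have "\<dots> \<in> Emb D" unfolding b_def by (rule emb[OF p pE])
    finally have "amap S b0 \<cdot> snd a \<in> Emb D"
      using D.Emb_right_factor[OF Sb0 S.T_hom[OF eh]] by blast
    \<comment> \<open>Here pathwise-embedding enters: each composite of \<open>f i\<close> with the
      path embedding \<open>e' i\<close> is an embedding, and \<open>H\<close> and \<open>S\<close>
      preserve this.\<close>
    moreover have "amap S (HU fe') \<in> Emb D"
      using HU_Emb[of fe', OF feE(2)] comonad_D_emb unfolding comonad_preserves_emb_def by blast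
    ultimately have "amap S (HU fe') \<cdot> amap S b0 \<cdot> snd a \<in> Emb D"
      by (rule D.Emb_Cmp[OF _ _ Sb0 S.T_hom[OF feh]])
    also have "amap S (HU fe') \<cdot> amap S b0 \<cdot> snd a = amap S (HU fe' \<cdot> b0) \<cdot> snd a"
      unfolding S.T_Cmp[OF b0(1) feh]
      by (rule D.Cmp_assoc[OF a'(2) S.T_hom[OF b0(1)] S.T_hom[OF feh], symmetric])
    also have "HU fe' \<cdot> b0 = HU f \<cdot> b"
    proof -
      have "HU fe' = HU f \<cdot> HU e'" using ex(1) f fe'_def by (rule HU_Cmp)
      then show ?thesis unfolding b0(2) using D.Cmp_assoc[OF b0(1) eh fh] by simp
    qed
    finally have "amap S (HU f \<cdot> b) \<cdot> snd a \<in> Emb D" .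
    moreover have "bim a (cof A) (HU f \<cdot> b)" by (rule bim_postcomp[OF ac f bb])
    \<comment> \<open>Passing from the bimorphism \<open>HU f \<cdot> b\<close> to its composite
      with the counits gives the arrow underlying the composite of \<open>phi\<close> and
      \<open>p\<close>.\<close>
    ultimately have "amap S (?e \<cdot> HU f \<cdot> b) \<cdot> snd a \<in> Emb D"
      using bim_cofree_Emb[OF ac A] by blast
    then have "under (phi \<cdot>\<^bsub>ED\<^esub> p) \<in> Emb D"
      unfolding phi_Cmp[OF p] b_def by (simp add: S.transpose_def)
    then show ?thesis using EM_Emb_iff[OF ED.Cmp_hom[OF p phi]] by blast
  qed
  have op: "\<exists>d \<in> hom ED q w. p = d \<cdot>\<^bsub>ED\<^esub> g \<and> m = phi \<cdot>\<^bsub>ED\<^esub> d"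
    if p: "p \<in> hom ED a w" and g: "g \<in> hom ED a q" and m: "m \<in> hom ED q ?FA"
      and aR: "a \<in> R" and qR: "q \<in> R" and sq: "phi \<cdot>\<^bsub>ED\<^esub> p = m \<cdot>\<^bsub>ED\<^esub> g" for a q p g m
  proof -
    have ac: "a \<in> coalgebras D S" and qc: "q \<in> coalgebras D S" using EM_hom_underD(2,3)[OF g] .
    have gh: "under g \<in> hom D (fst a) (fst q)" using under_hom[OF g] .
    define b where "b = u \<cdot> under p"
    have bb: "bim a z b" unfolding b_def by (rule bp[OF p])
    note bh = bim_hom[OF bb]
    \<comment> \<open>\<open>M'\<close> is the arrow whose transpose is \<open>m\<close>, and
      \<open>M\<close> below is the bimorphism into the cofree coalgebras that corresponds to
      \<open>M'\<close>.\<close>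
    define M' where "M' = counit S (Hob A) \<cdot> under m"
    have mh: "under m \<in> hom D (fst q) (omap S (Hob A))" using under_hom[OF m] by (simp add: cofree_def)
    have M'h: "M' \<in> hom D (fst q) (Hob A)" unfolding M'_def by (rule D.Cmp_hom[OF mh S.counit_hom[OF HA]])
    define M where "M = kap A \<cdot> amap S M' \<cdot> snd q"
    have bM: "bim q (cof A) M" unfolding M_def by (rule bim_cofree[OF qc A M'h])
    have eM: "?e \<cdot> M = M'" unfolding M_def by (rule counit_bim_cofree[OF qc A M'h])
    note Mh = bim_hom[OF bM]
    have bMg: "bim a (cof A) (M \<cdot> under g)" by (rule bim_precomp[OF bM g cA])
    \<comment> \<open>The given square, translated to bimorphisms. Both sides go into cofree
      coalgebras, so it is enough to compare them after the counits, where \<open>sq\<close>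
      applies.\<close>
    have fb: "HU f \<cdot> b = M \<cdot> under g"
    proof (rule bim_cofree_eqI[OF ac A bim_postcomp[OF ac f bb] bMg])
      have "?e \<cdot> HU f \<cdot> b = counit S (Hob A) \<cdot> under (phi \<cdot>\<^bsub>ED\<^esub> p)"
        unfolding phi_Cmp[OF p] b_def[symmetric]
        by (rule S.counit_transpose[OF ac D.Cmp_hom[OF D.Cmp_hom[OF bh fh] e], symmetric])
      also have "\<dots> = counit S (Hob A) \<cdot> under m \<cdot> under g" unfolding sq by simp
      also have "\<dots> = (?e \<cdot> M) \<cdot> under g"
        unfolding eM M'_def by (rule D.Cmp_assoc[OF gh mh S.counit_hom[OF HA], symmetric])
      also have "\<dots> = ?e \<cdot> M \<cdot> under g" by (rule D.Cmp_assoc[OF gh Mh e])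
      finally show "?e \<cdot> HU f \<cdot> b = ?e \<cdot> M \<cdot> under g" .
    qed
    obtain x e' b0 where dec: "path_decomposition a z b x e' b0"
      using minimal_path_decomposition[OF aR z bb] by metis
    note ex = path_decompositionD(1-3)[OF dec] and b0 = path_decompositionD(4,5)[OF dec]
    obtain y k M0 where kdec: "path_decomposition q (cof A) M y k M0"
      using minimal_path_decomposition[OF qR cA bM] by metis
    note ky = path_decompositionD(1-3)[OF kdec] and M0 = path_decompositionD(4,5)[OF kdec]
    \<comment> \<open>The common bimorphism has two decompositions, one through the
      \<open>fe' i\<close> and one through the \<open>k i\<close>. A minimal decomposition maps to
      both and thereby yields one square for every \<open>i\<close>.\<close>
    obtain L l l0 where ldec: "path_decomposition a (cof A) (M \<cdot> under g) L l l0"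
      and mini: "\<forall>y k k0. path_decomposition a (cof A) (M \<cdot> under g) y k k0 \<longrightarrow>
       (\<exists>h. \<forall>i\<in>I. h i \<in> hom (EC i) (L i) (y i) \<and> l i = k i \<cdot>\<^bsub>EC i\<^esub> h i)"
      using minimal_path_decomposition[OF aR cA bMg] by blast
    note lL = path_decompositionD(1-3)[OF ldec] and l0 = path_decompositionD(4,5)[OF ldec]
    define fe' where "fe' i = f i \<cdot>\<^bsub>EC i\<^esub> e' i" for i
    have feE: "fe' i \<in> hom (EC i) (x i) (cof A i)" "fe' i \<in> Emb (EC i)" if "i \<in> I" for i
      unfolding fe'_def by (rule fe[OF that ex[OF that]])+
    have eh: "HU e' \<in> hom D (UO x) (UO z)" by (rule HU_hom) (rule ex)
    have feh: "HU fe' \<in> hom D (UO x) (UO (cof A))" by (rule HU_hom) (rule feE)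
    have kh: "HU k \<in> hom D (UO y) (UO (cof A))" by (rule HU_hom) (rule ky)
    have feb: "M \<cdot> under g = HU fe' \<cdot> b0"
    proof -
      have "HU fe' = HU f \<cdot> HU e'" using ex(1) f fe'_def by (rule HU_Cmp)
      then show ?thesis unfolding fb[symmetric] b0(2) using D.Cmp_assoc[OF b0(1) eh fh] by simp
    qed
    have M0g: "M0 \<cdot> under g \<in> hom D (fst a) (UO y)" by (rule D.Cmp_hom[OF gh M0(1)])
    have kM0: "M \<cdot> under g = HU k \<cdot> M0 \<cdot> under g"
      unfolding M0(2) by (rule D.Cmp_assoc[OF gh M0(1) kh])
    obtain s where s: "\<And>i. i \<in> I \<Longrightarrow> s i \<in> hom (EC i) (L i) (x i)"
      "\<And>i. i \<in> I \<Longrightarrow> l i = fe' i \<cdot>\<^bsub>EC i\<^esub> s i"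
      using mini[rule_format, OF path_decompositionI[OF feE ex(3) b0(1) feb]] by blast
    obtain t where t: "\<And>i. i \<in> I \<Longrightarrow> t i \<in> hom (EC i) (L i) (y i)"
      "\<And>i. i \<in> I \<Longrightarrow> l i = k i \<cdot>\<^bsub>EC i\<^esub> t i"
      using mini[rule_format, OF path_decompositionI[OF ky M0g kM0]] by blast
    have "\<exists>d. d \<in> hom (EC i) (y i) (z i) \<and> e' i \<cdot>\<^bsub>EC i\<^esub> s i = d \<cdot>\<^bsub>EC i\<^esub> t i \<and> k i = f i \<cdot>\<^bsub>EC i\<^esub> d"
      if i: "i \<in> I" for i
    proof -
      interpret EC: path_category "EC i" by (rule EM_C[OF i])
      note esh = EC.Cmp_hom[OF s(1)[OF i] ex(1)[OF i]]
      \<comment> \<open>Both are right factors of the embedding \<open>l i\<close>.\<close>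
      have "s i \<in> Emb (EC i)" "t i \<in> Emb (EC i)"
        using EC.Emb_right_factor[OF s(1)[OF i] feE(1)[OF i]] EC.Emb_right_factor[OF t(1)[OF i] ky(1)[OF i]]
          lL(2)[OF i] s(2)[OF i] t(2)[OF i] by metis+
      moreover from this have "e' i \<cdot>\<^bsub>EC i\<^esub> s i \<in> Emb (EC i)"
        using EC.Emb_Cmp[OF _ _ s(1)[OF i] ex(1)[OF i]] ex(2)[OF i] by blast
      ultimately have pe: "path_embedding (EC i) (e' i \<cdot>\<^bsub>EC i\<^esub> s i)" "path_embedding (EC i) (t i)"
        "path_embedding (EC i) (k i)"
        using path_embeddingI[OF esh] path_embeddingI[OF t(1)[OF i]] path_embeddingI[OF ky(1)[OF i]]
          lL(3)[OF i] ky(2,3)[OF i] unfolding EM_simps(9) by blast+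
      have "f i \<cdot>\<^bsub>EC i\<^esub> (e' i \<cdot>\<^bsub>EC i\<^esub> s i) = l i"
        unfolding s(2)[OF i] fe'_def by (rule EC.Cmp_assoc[OF s(1)[OF i] ex(1)[OF i] f[OF i], symmetric])
      also have "\<dots> = k i \<cdot>\<^bsub>EC i\<^esub> t i" by (rule t(2)[OF i])
      finally show ?thesis
        by (rule open_pathwise_embeddingD(2)[OF fop[OF i] f[OF i] pe esh t(1)[OF i] ky(1)[OF i]])
    qed
    then obtain d where d: "\<And>i. i \<in> I \<Longrightarrow> d i \<in> hom (EC i) (y i) (z i)"
      "\<And>i. i \<in> I \<Longrightarrow> e' i \<cdot>\<^bsub>EC i\<^esub> s i = d i \<cdot>\<^bsub>EC i\<^esub> t i"
      "\<And>i. i \<in> I \<Longrightarrow> k i = f i \<cdot>\<^bsub>EC i\<^esub> d i" by metis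
    have dh: "HU d \<in> hom D (UO y) (UO z)" by (rule HU_hom) (rule d)
    have sh: "HU s \<in> hom D (UO L) (UO x)" by (rule HU_hom) (rule s)
    have th: "HU t \<in> hom D (UO L) (UO y)" by (rule HU_hom) (rule t)
    \<comment> \<open>The decomposition of \<open>M\<close> supplies \<open>M0\<close> merely as an
      arrow of \<open>D\<close>; it is a bimorphism because the embeddings \<open>k i\<close>
      reflect bimorphisms.\<close>
    have bM0: "bim q y M0" by (rule bim_reflect[OF qc ky(1,2) M0(1) bM[unfolded M0(2)]])
    have bN: "bim q z (HU d \<cdot> M0)" by (rule bim_postcomp[OF qc d(1) bM0])
    note Nh = bim_hom[OF bN]
    \<comment> \<open>The filler is the morphism into \<open>w\<close> that classifies the
      bimorphism \<open>HU d \<cdot> M0\<close>.\<close>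
    obtain d' where d': "d' \<in> hom ED q w" "u \<cdot> under d' = HU d \<cdot> M0"
      using univ[OF qc bN] by blast
    \<comment> \<open>The axiom relates only the embeddings of the decompositions. Their remaining
      factors are related here and in \<open>sl\<close> by cancelling the monic arrows
      \<open>HU k\<close> and \<open>HU fe'\<close>.\<close>
    have tl: "M0 \<cdot> under g = HU t \<cdot> l0"
    proof (rule Emb_left_cancel[OF HU_Emb kh M0g D.Cmp_hom[OF l0(1) th]])
      have "HU l = HU k \<cdot> HU t" using t(1) ky(1) t(2) by (rule HU_Cmp)
      then show "HU k \<cdot> M0 \<cdot> under g = HU k \<cdot> HU t \<cdot> l0"
        using kM0 l0(2) D.Cmp_assoc[OF l0(1) th kh] by metis
    qed (rule ky)
    have sl: "b0 = HU s \<cdot> l0"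
    proof (rule Emb_left_cancel[OF HU_Emb feh b0(1) D.Cmp_hom[OF l0(1) sh]])
      have "HU l = HU fe' \<cdot> HU s" using s(1) feE(1) s(2) by (rule HU_Cmp)
      then show "HU fe' \<cdot> b0 = HU fe' \<cdot> HU s \<cdot> l0"
        using feb l0(2) D.Cmp_assoc[OF l0(1) sh feh] by metis
    qed (rule feE)
    have esdt: "HU e' \<cdot> HU s = HU d \<cdot> HU t"
    proof -
      have "HU (\<lambda>i. e' i \<cdot>\<^bsub>EC i\<^esub> s i) = HU e' \<cdot> HU s" using s(1) ex(1) refl by (rule HU_Cmp)
      moreover have "HU (\<lambda>i. e' i \<cdot>\<^bsub>EC i\<^esub> s i) = HU d \<cdot> HU t" using t(1) d(1,2) by (rule HU_Cmp)
      ultimately show ?thesis by metis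
    qed
    \<comment> \<open>The first triangle on the level of bimorphisms: both composites factor through
      \<open>l0\<close>, and the families \<open>d\<close>, \<open>t\<close>, \<open>e'\<close>,
      \<open>s\<close> commute componentwise.\<close>
    have Ng: "(HU d \<cdot> M0) \<cdot> under g = b"
    proof -
      have "(HU d \<cdot> M0) \<cdot> under g = HU d \<cdot> M0 \<cdot> under g" by (rule D.Cmp_assoc[OF gh M0(1) dh])
      also have "\<dots> = (HU d \<cdot> HU t) \<cdot> l0" unfolding tl by (rule D.Cmp_assoc[OF l0(1) th dh, symmetric])
      also have "\<dots> = HU e' \<cdot> HU s \<cdot> l0"
        unfolding esdt[symmetric] by (rule D.Cmp_assoc[OF l0(1) sh eh])
      also have "\<dots> = b" unfolding b0(2) sl ..
      finally show ?thesis .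
    qed
    have d'g: "d' \<cdot>\<^bsub>ED\<^esub> g \<in> hom ED a w" by (rule ED.Cmp_hom[OF g d'(1)])
    have ud'g: "u \<cdot> under (d' \<cdot>\<^bsub>ED\<^esub> g) = b"
    proof -
      have "u \<cdot> under (d' \<cdot>\<^bsub>ED\<^esub> g) = u \<cdot> under d' \<cdot> under g" by simp
      also have "\<dots> = (u \<cdot> under d') \<cdot> under g"
        by (rule D.Cmp_assoc[OF gh under_hom[OF d'(1)] uh, symmetric])
      finally show ?thesis unfolding d'(2) Ng .
    qed
    note the_eq = the1_equality[OF univ[OF ac bb]]
    \<comment> \<open>Both morphisms into \<open>w\<close> induce the bimorphism \<open>b\<close>,
      so they agree by universality of \<open>u\<close>.\<close>
    have pd: "p = d' \<cdot>\<^bsub>ED\<^esub> g"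
      by (rule trans[OF the_eq[OF conjI[OF p b_def[symmetric]], symmetric] the_eq[OF conjI[OF d'g ud'g]]])
    \<comment> \<open>The second triangle on the level of bimorphisms; composing with the counits
      and transposing turns it into the required equation for \<open>m\<close>.\<close>
    have "HU f \<cdot> HU d \<cdot> M0 = M"
    proof -
      have "HU k = HU f \<cdot> HU d" using d(1) f d(3) by (rule HU_Cmp)
      then show ?thesis unfolding M0(2) using D.Cmp_assoc[OF M0(1) dh fh] by metis
    qed
    then have "phi \<cdot>\<^bsub>ED\<^esub> d' = S.transpose q (Hob A) M'"
      unfolding phi_Cmp[OF d'(1)] d'(2) using eM by metis
    also have "\<dots> = m" unfolding M'_def by (rule S.transpose_counit[OF m HA])
    finally show ?thesis using d'(1) pd by blast
  qed
  show "open_pathwise_embedding ED phi"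
  proof (rule open_pathwise_embeddingI[OF phi], unfold EM_simps(9))
    show "Emb ED \<subseteq> Ar ED" using ED.Emb_Ar by blast
  qed (rule pe op; assumption)+
qed

section \<open>Spans for the lifted coalgebras\<close>

text \<open>The universal bimorphism depends only on the apexes \<open>z i\<close>, which the two
  legs of each span share. Hence the comparison morphisms induced by the left legs and by the right
  legs have the same source \<open>w\<close> and form a span.\<close>

lemma comonad_equiv_Hob:
  assumes A: "\<And>i. i \<in> I \<Longrightarrow> A i \<in> Ob (C i)" and B: "\<And>i. i \<in> I \<Longrightarrow> B i \<in> Ob (C i)"
    and equiv: "\<And>i. i \<in> I \<Longrightarrow> comonad_equiv (C i) (T i) (P i) (A i) (B i)"
  shows "comonad_equiv D S R (Hob A) (Hob B)"
proof -
  \<comment> \<open>The apex and both legs are packed into one triple, so that a single choice over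
    \<open>i\<close> suffices.\<close>
  have "\<exists>x. fst x \<in> coalgebras (C i) (T i) \<and>
      fst (snd x) \<in> hom (EC i) (fst x) (cof A i) \<and> open_pathwise_embedding (EC i) (fst (snd x)) \<and>
      snd (snd x) \<in> hom (EC i) (fst x) (cof B i) \<and> open_pathwise_embedding (EC i) (snd (snd x))"
    if "i \<in> I" for i
    using equiv[OF that] unfolding comonad_equiv_def EM_simps(1) by fastforce
  then obtain x where x: "\<And>i. i \<in> I \<Longrightarrow> fst (x i) \<in> coalgebras (C i) (T i) \<and>
      fst (snd (x i)) \<in> hom (EC i) (fst (x i)) (cof A i) \<and> open_pathwise_embedding (EC i) (fst (snd (x i))) \<and>
      snd (snd (x i)) \<in> hom (EC i) (fst (x i)) (cof B i) \<and> open_pathwise_embedding (EC i) (snd (snd (x i)))"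
    by metis
  define z f g where "z i = fst (x i)" and "f i = fst (snd (x i))" and "g i = snd (snd (x i))" for i
  have z: "z i \<in> coalgebras (C i) (T i)"
    and f: "f i \<in> hom (EC i) (z i) (cof A i)" "open_pathwise_embedding (EC i) (f i)"
    and g: "g i \<in> hom (EC i) (z i) (cof B i)" "open_pathwise_embedding (EC i) (g i)" if "i \<in> I" for i
    using x[OF that] unfolding z_def f_def g_def by blast+
  obtain w u where wu: "w \<in> coalgebras D S" "bim w z u"
    "\<And>a b. \<lbrakk>a \<in> coalgebras D S; bim a z b\<rbrakk> \<Longrightarrow> \<exists>!p. p \<in> hom ED a w \<and> u \<cdot> under p = b"
    "\<And>a p. \<lbrakk>p \<in> hom ED a w; p \<in> Emb ED\<rbrakk> \<Longrightarrow> amap S (u \<cdot> under p) \<cdot> snd a \<in> Emb D"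
    by (rule universal_bimorphism[OF z]) blast+
  note F = open_pathwise_embedding_transpose[OF z A f wu refl]
    and G = open_pathwise_embedding_transpose[OF z B g wu refl]
  show ?thesis unfolding comonad_equiv_def EM_simps(1) using wu(1) F G by blast
qed

end

theorem theorem6p9:
  fixes n :: nat
    and C :: "nat \<Rightarrow> ('o, 'm) fact_cat"
    and T :: "nat \<Rightarrow> ('o, 'm) comonad_data"
    and P :: "nat \<Rightarrow> ('o, 'm) coalg set"
    and D :: "('p, 'q) fact_cat"
    and S :: "('p, 'q) comonad_data"
    and R :: "('p, 'q) coalg set"
    and H :: "(nat \<Rightarrow> 'o, nat \<Rightarrow> 'm, 'p, 'q) func"
    and \<kappa> :: "(nat \<Rightarrow> 'o) \<Rightarrow> 'q"
    and A B :: "nat \<Rightarrow> 'o"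
  assumes base_C: "\<And>i. i \<in> {1..n} \<Longrightarrow> proper_fact_category (C i)"
    and base_D: "proper_fact_category D"
    and H: "cat_functor (prod_cat {1..n} C) D H"
    and comonad_C: "\<And>i. i \<in> {1..n} \<Longrightarrow> comonad (C i) (T i)"
    and comonad_D: "comonad D S"
    and comonad_C_emb: "\<And>i. i \<in> {1..n} \<Longrightarrow> comonad_preserves_emb (C i) (T i)"
    and comonad_D_emb: "comonad_preserves_emb D S"
    and EM_C: "\<And>i. i \<in> {1..n} \<Longrightarrow> path_category (EM (C i) (T i) (P i))"
    and EM_D: "path_category (EM D S R)"
    and EM_D_eq: "has_equalisers (EM D S R)"
    and H_emb: "functor_preserves_emb {1..n} C D H"
    and \<kappa>: "kleisli_law {1..n} C T D S H \<kappa>"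
    and S2': "axiom_S2' {1..n} C T P D S R H \<kappa>"
    and A: "A \<in> Ob (prod_cat {1..n} C)"
    and B: "B \<in> Ob (prod_cat {1..n} C)"
    and equiv: "\<And>i. i \<in> {1..n} \<Longrightarrow> comonad_equiv (C i) (T i) (P i) (A i) (B i)"
  shows "comonad_equiv D S R (omap H A) (omap H B)"
proof -
  interpret kleisli_setting "{1..n}" C T P D S R H \<kappa>
    by (intro kleisli_setting.intro kleisli_setting_axioms.intro; fact assms)
  \<comment> \<open>Objects of the product category are extensional, so the restriction inside
    \<open>Hob\<close> leaves \<open>A\<close> and \<open>B\<close> unchanged.\<close>
  have ext: "(\<lambda>i\<in>{1..n}. X i) = X" and Ob: "i \<in> {1..n} \<Longrightarrow> X i \<in> Ob (C i)"
    if "X \<in> Ob (prod_cat {1..n} C)" for X i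
    using that by (auto simp: prod_cat_def PiE_restrict)
  show ?thesis
    using comonad_equiv_Hob[OF Ob[OF A] Ob[OF B] equiv] unfolding Hob_def ext[OF A] ext[OF B] .
qed

end
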